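(* Let $\pi_n$, with $\frac{d\pi_n}{d\tilde\pi_n}(x)=\exp\{-\phi_n(x)\}$, $\tilde{\pi}_n(x)=\prod_{i=1}^n \lambda_i^{-1} f(x_i/\lambda_i)$, $\lambda_i=i^{-\kappa}$, $\kappa\ge 0$, be the target distribution for RWM and SLA. Assume that $\sigma_n^2=l^2n^{-\rho}$ for constants $l,\rho>0$. Suppose that there exists $M>0$ such that for all sufficiently large $n$, $|\phi_n(x)|\le M$ for all $x\in\mathbb{R}^n$. Let $I=1$ for RWM and $I=1/3$ for SLA. Then, for each of the two algorithms with its own $I$, with $x\sim\pi_n$ and $y$ the proposal from $x$, as $n\to\infty$: (i) if $\rho\ge 2\kappa+I$, then $\liminf_{n\to\infty}E[a_n(x,y)]>0$; (ii) if $2\kappa<\rho<2\kappa+I$, then $n^pE[a_n(x,y)]\to 0$ for any $p\ge 0$.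
   Context: Density $f$. $f=\exp\{-g\}$ is a probability density on $\mathbb{R}$, where $g:\mathbb{R}\to\mathbb{R}$ is infinitely differentiable, $g$ and each of its derivatives are bounded in absolute value by a polynomial, and all moments of $f$ are finite. Target. For each $n$, $\phi_n:\mathbb{R}^n\to\mathbb{R}$ is Borel measurable and $\pi_n$ is the probability measure with density $\exp\{-\phi_n\}$ with respect to $\tilde\pi_n$; $\pi_n(x)$ also denotes its Lebesgue density. Algorithms. A Metropolis–Hastings step from $x\in\mathbb{R}^n$ draws a proposal $y$ from a transition density $q_n(x,\cdot)$ and moves to $x'=y$ with probability $a_n(x,y)$, otherwise $x'=x$, where $a_n(x,y)=1\wedge\frac{\pi_n(y)q_n(y,x)}{\pi_n(x)q_n(x,y)}$ if $\pi_n(x)q_n(x,y)>0$ and $a_n(x,y)=0$ otherwise. With $Z\sim\mathcal{N}(0,I_n)$ independent of $x$ and step-size $\sigma_n>0$, the proposals are RWM: $y=x+\sigma_n Z$; SLA: $y=x+\frac{\sigma_n^2}{2}\nabla\log\tilde\pi_n(x)+\sigma_n Z$, i.e. $y_i=x_i-\frac{\sigma_n^2}{2\lambda_i}g'(x_i/\lambda_i)+\sigma_nZ_i$ (the gradient uses the reference law $\tilde\pi_n$, while the acceptance probability uses $\pi_n$). *)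

theory Defs
  imports "HOL-Probability.Probability" "HOL-Computational_Algebra.Polynomial"
begin

text \<open>
  A point of n-dimensional space is a function \<open>nat \<Rightarrow> real\<close> that is extensional on \<open>{1..n}\<close>,
  i.e. an element of the space of \<open>lebesgue_n n\<close>.
\<close>

abbreviation lebesgue_n :: "nat \<Rightarrow> (nat \<Rightarrow> real) measure" where
  "lebesgue_n n \<equiv> PiM {1..n} (\<lambda>_. lborel)"

definition std_gaussian :: "nat \<Rightarrow> (nat \<Rightarrow> real) measure" where
  "std_gaussian n = PiM {1..n} (\<lambda>_. density lborel std_normal_density)"

definition infinitely_differentiable :: "(real \<Rightarrow> real) \<Rightarrow> bool" where
  "infinitely_differentiable g \<longleftrightarrow> (\<forall>k x. (deriv ^^ k) g differentiable (at x))"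

definition polynomially_bounded :: "(real \<Rightarrow> real) \<Rightarrow> bool" where
  "polynomially_bounded h \<longleftrightarrow> (\<exists>P :: real poly. \<forall>x. \<bar>h x\<bar> \<le> poly P x)"

definition coord_scale :: "real \<Rightarrow> nat \<Rightarrow> real" where
  "coord_scale \<kappa> i = real i powr (- \<kappa>)"

definition ref_density :: "(real \<Rightarrow> real) \<Rightarrow> real \<Rightarrow> nat \<Rightarrow> (nat \<Rightarrow> real) \<Rightarrow> real" where
  "ref_density f \<kappa> n x = (\<Prod>i\<in>{1..n}. inverse (coord_scale \<kappa> i) * f (x i / coord_scale \<kappa> i))"

definition ref_measure :: "(real \<Rightarrow> real) \<Rightarrow> real \<Rightarrow> nat \<Rightarrow> (nat \<Rightarrow> real) measure" where
  "ref_measure f \<kappa> n = density (lebesgue_n n) (\<lambda>x. ennreal (ref_density f \<kappa> n x))"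

text \<open>In the following, \<open>\<phi>\<close> is the function for the given dimension \<open>n\<close>.\<close>

definition target_measure ::
    "(real \<Rightarrow> real) \<Rightarrow> real \<Rightarrow> nat \<Rightarrow> ((nat \<Rightarrow> real) \<Rightarrow> real) \<Rightarrow> (nat \<Rightarrow> real) measure" where
  "target_measure f \<kappa> n \<phi> = density (ref_measure f \<kappa> n) (\<lambda>x. ennreal (exp (- \<phi> x)))"

definition target_density ::
    "(real \<Rightarrow> real) \<Rightarrow> real \<Rightarrow> nat \<Rightarrow> ((nat \<Rightarrow> real) \<Rightarrow> real) \<Rightarrow> (nat \<Rightarrow> real) \<Rightarrow> real" where
  "target_density f \<kappa> n \<phi> x = exp (- \<phi> x) * ref_density f \<kappa> n x"

definition partial_deriv :: "((nat \<Rightarrow> real) \<Rightarrow> real) \<Rightarrow> nat \<Rightarrow> (nat \<Rightarrow> real) \<Rightarrow> real" where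
  "partial_deriv F i x = deriv (\<lambda>t. F (x(i := t))) (x i)"

datatype algorithm = RWM | SLA

fun critical_exponent :: "algorithm \<Rightarrow> real" where
  "critical_exponent RWM = 1"
| "critical_exponent SLA = 1 / 3"

text \<open>
  The SLA drift is the gradient of the log density of the reference law, not of the target;
  it is computed explicitly in \<open>proposal_mean_SLA\<close> below.
\<close>

fun proposal_mean ::
    "algorithm \<Rightarrow> (real \<Rightarrow> real) \<Rightarrow> real \<Rightarrow> nat \<Rightarrow> real \<Rightarrow> (nat \<Rightarrow> real) \<Rightarrow> nat \<Rightarrow> real" where
  "proposal_mean RWM f \<kappa> n s x i = x i"
| "proposal_mean SLA f \<kappa> n s x i =
     x i + s\<^sup>2 / 2 * partial_deriv (\<lambda>u. ln (ref_density f \<kappa> n u)) i x"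

definition proposal ::
    "algorithm \<Rightarrow> (real \<Rightarrow> real) \<Rightarrow> real \<Rightarrow> nat \<Rightarrow> real \<Rightarrow> (nat \<Rightarrow> real) \<Rightarrow> (nat \<Rightarrow> real) \<Rightarrow> nat \<Rightarrow> real" where
  "proposal A f \<kappa> n s x z = (\<lambda>i\<in>{1..n}. proposal_mean A f \<kappa> n s x i + s * z i)"

text \<open>
  The Lebesgue density of the proposal from \<open>x\<close> with standard Gaussian noise,
  see \<open>distr_proposal\<close> below.
\<close>

definition proposal_density ::
    "algorithm \<Rightarrow> (real \<Rightarrow> real) \<Rightarrow> real \<Rightarrow> nat \<Rightarrow> real \<Rightarrow> (nat \<Rightarrow> real) \<Rightarrow> (nat \<Rightarrow> real) \<Rightarrow> real" where
  "proposal_density A f \<kappa> n s x y =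
     (\<Prod>i\<in>{1..n}. normal_density (proposal_mean A f \<kappa> n s x i) s (y i))"

definition mh_acceptance ::
    "('a \<Rightarrow> real) \<Rightarrow> ('a \<Rightarrow> 'a \<Rightarrow> real) \<Rightarrow> 'a \<Rightarrow> 'a \<Rightarrow> real" where
  "mh_acceptance p q x y =
     (if p x * q x y > 0 then min 1 ((p y * q y x) / (p x * q x y)) else 0)"

definition acceptance_prob ::
    "algorithm \<Rightarrow> (real \<Rightarrow> real) \<Rightarrow> real \<Rightarrow> nat \<Rightarrow> real \<Rightarrow> ((nat \<Rightarrow> real) \<Rightarrow> real) \<Rightarrow>
      (nat \<Rightarrow> real) \<Rightarrow> (nat \<Rightarrow> real) \<Rightarrow> real" where
  "acceptance_prob A f \<kappa> n s \<phi> =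
     mh_acceptance (target_density f \<kappa> n \<phi>) (proposal_density A f \<kappa> n s)"

text \<open>The product measure expresses that the noise \<open>z\<close> is independent of the current state \<open>x\<close>.\<close>

definition mean_acceptance ::
    "algorithm \<Rightarrow> (real \<Rightarrow> real) \<Rightarrow> real \<Rightarrow> nat \<Rightarrow> real \<Rightarrow> ((nat \<Rightarrow> real) \<Rightarrow> real) \<Rightarrow> real" where
  "mean_acceptance A f \<kappa> n s \<phi> =
     (\<integral>(x, z). acceptance_prob A f \<kappa> n s \<phi> x (proposal A f \<kappa> n s x z)
        \<partial>(target_measure f \<kappa> n \<phi> \<Otimes>\<^sub>M std_gaussian n))"

lemma coord_scale_pos: "i \<ge> 1 \<Longrightarrow> coord_scale \<kappa> i > 0"
  by (simp add: coord_scale_def)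

lemma proposal_mean_SLA:
  assumes g: "infinitely_differentiable g" and f: "f = (\<lambda>x. exp (- g x))" and i: "i \<in> {1..n}"
  shows "proposal_mean SLA f \<kappa> n s x i =
           x i - s\<^sup>2 / (2 * coord_scale \<kappa> i) * deriv g (x i / coord_scale \<kappa> i)"
proof -
  let ?c = "coord_scale \<kappa> i"
  have c: "?c > 0"
    using i by (intro coord_scale_pos) auto
  from c have c_nz: "?c \<noteq> 0"
    by simp
  have dg: "(g has_real_derivative deriv g t) (at t)" for t
  proof -
    have "(deriv ^^ 0) g differentiable (at t)"
      using g unfolding infinitely_differentiable_def by blast
    then show ?thesis
      by (simp add: DERIV_deriv_iff_real_differentiable)
  qed
  have ln_ref: "ln (ref_density f \<kappa> n u) =
      (\<Sum>j\<in>{1..n}. ln (inverse (coord_scale \<kappa> j)) - g (u j / coord_scale \<kappa> j))" for u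
  proof -
    have "ln (ref_density f \<kappa> n u) =
        (\<Sum>j\<in>{1..n}. ln (inverse (coord_scale \<kappa> j) * f (u j / coord_scale \<kappa> j)))"
      unfolding ref_density_def by (intro ln_prod) (auto simp: f coord_scale_def)
    also have "\<dots> = (\<Sum>j\<in>{1..n}. ln (inverse (coord_scale \<kappa> j)) - g (u j / coord_scale \<kappa> j))"
    proof (intro sum.cong refl)
      fix j assume "j \<in> {1..n}"
      then have "coord_scale \<kappa> j > 0"
        by (intro coord_scale_pos) auto
      then show "ln (inverse (coord_scale \<kappa> j) * f (u j / coord_scale \<kappa> j)) =
          ln (inverse (coord_scale \<kappa> j)) - g (u j / coord_scale \<kappa> j)"
        by (simp add: f ln_mult_pos)
    qed
    finally show ?thesis .
  qed
  define R where "R = (\<Sum>j\<in>{1..n} - {i}. ln (inverse (coord_scale \<kappa> j)) - g (x j / coord_scale \<kappa> j))"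
  have eq: "ln (ref_density f \<kappa> n (x(i := t))) = ln (inverse ?c) - g (t / ?c) + R" for t
    unfolding ln_ref R_def using i by (subst sum.remove[of _ i]) (auto intro!: sum.cong)
  have "((\<lambda>t. ln (inverse ?c) - g (t / ?c) + R) has_real_derivative
      - (deriv g (x i / ?c) * (1 / ?c))) (at (x i))"
    by (auto intro!: derivative_eq_intros DERIV_chain2[where f=g, OF dg] simp: c_nz)
  then have "partial_deriv (\<lambda>u. ln (ref_density f \<kappa> n u)) i x = - (deriv g (x i / ?c) * (1 / ?c))"
    unfolding partial_deriv_def eq by (rule DERIV_imp_deriv)
  then show ?thesis
    by (simp add: field_simps)
qed

lemma target_measure_eq_density:
  assumes f: "f \<in> borel_measurable borel" "\<And>x. f x \<ge> 0"
    and \<phi>: "\<phi> \<in> borel_measurable (lebesgue_n n)"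
  shows "target_measure f \<kappa> n \<phi> = density (lebesgue_n n) (\<lambda>x. ennreal (target_density f \<kappa> n \<phi> x))"
proof -
  note [measurable] = f(1) \<phi>
  have [measurable]: "ref_density f \<kappa> n \<in> borel_measurable (lebesgue_n n)"
    unfolding ref_density_def[abs_def] by measurable
  have "ref_density f \<kappa> n x \<ge> 0" for x
    unfolding ref_density_def
    by (intro prod_nonneg mult_nonneg_nonneg f(2)) (auto simp: coord_scale_def)
  then show ?thesis
    unfolding target_measure_def ref_measure_def target_density_def
    by (subst density_density_eq) (simp_all only: ennreal_mult mult.commute exp_ge_zero, measurable)
qed

lemma distr_proposal:
  assumes s: "s > 0"
  shows "distr (std_gaussian n) (lebesgue_n n) (proposal A f \<kappa> n s x) =
           density (lebesgue_n n) (\<lambda>y. ennreal (proposal_density A f \<kappa> n s x y))"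
proof -
  define m where "m = proposal_mean A f \<kappa> n s x"
  define N where "N = (\<lambda>i. density lborel (normal_density (m i) s))"
  let ?S = "density lborel std_normal_density"
  interpret S: prob_space ?S
    by (rule prob_space_normal_density) simp
  interpret PS: product_prob_space "\<lambda>_::nat. ?S" ..
  have pN: "prob_space (N i)" for i
    unfolding N_def using s by (rule prob_space_normal_density)
  interpret PN: product_prob_space N
    by (rule product_prob_spaceI) (rule pN)
  interpret L: product_sigma_finite "\<lambda>_::nat. lborel :: real measure" ..
  have N_distr: "distr ?S lborel (\<lambda>t. m i + s * t) = N i" for i
  proof -
    have "distributed ?S lborel (\<lambda>t. t) (\<lambda>t. ennreal (std_normal_density t))"
      unfolding distributed_def by (auto simp: distr_id2 cong: distr_cong)
    from S.normal_density_affine[OF this, of s "m i"] s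
    show ?thesis
      by (simp add: distributed_def N_def)
  qed
  have sets_N: "sets (PiM {1..n} N) = sets (lebesgue_n n)"
    by (intro sets_PiM_cong) (auto simp: N_def)
  have meas [measurable]: "proposal A f \<kappa> n s x \<in> measurable (std_gaussian n) (lebesgue_n n)"
    unfolding proposal_def std_gaussian_def by measurable
  have 1: "distr (std_gaussian n) (lebesgue_n n) (proposal A f \<kappa> n s x) = PiM {1..n} N"
  proof (rule PN.PiM_eqI)
    fix B assume B: "\<And>i. i \<in> {1..n} \<Longrightarrow> B i \<in> sets (N i)"
    then have B': "\<And>i. i \<in> {1..n} \<Longrightarrow> B i \<in> sets borel"
      by (auto simp: N_def)
    have "emeasure (distr (std_gaussian n) (lebesgue_n n) (proposal A f \<kappa> n s x)) (Pi\<^sub>E {1..n} B) =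
        emeasure (std_gaussian n) (proposal A f \<kappa> n s x -` Pi\<^sub>E {1..n} B \<inter> space (std_gaussian n))"
      using B' by (intro emeasure_distr meas sets_PiM_I_finite) auto
    also have "proposal A f \<kappa> n s x -` Pi\<^sub>E {1..n} B \<inter> space (std_gaussian n) =
        Pi\<^sub>E {1..n} (\<lambda>i. (\<lambda>t. m i + s * t) -` B i)"
      by (auto simp: proposal_def std_gaussian_def space_PiM PiE_def Pi_def extensional_def m_def)
    also have "emeasure (std_gaussian n) \<dots> =
        (\<Prod>i\<in>{1..n}. emeasure ?S ((\<lambda>t. m i + s * t) -` B i))"
      unfolding std_gaussian_def
    proof (rule PS.emeasure_PiM)
      fix i assume "i \<in> {1..n}"
      then have "(\<lambda>t. m i + s * t) -` B i \<inter> space borel \<in> sets borel"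
        by (intro measurable_sets[OF _ B']) auto
      then show "(\<lambda>t. m i + s * t) -` B i \<in> sets ?S"
        by simp
    qed simp
    also have "\<dots> = (\<Prod>i\<in>{1..n}. emeasure (N i) (B i))"
      unfolding N_distr[symmetric] using B' by (intro prod.cong) (auto simp: emeasure_distr)
    finally show "emeasure (distr (std_gaussian n) (lebesgue_n n) (proposal A f \<kappa> n s x))
        (Pi\<^sub>E {1..n} B) = (\<Prod>i\<in>{1..n}. emeasure (N i) (B i))" .
  qed (simp_all only: sets_N sets_distr sets_density finite_atLeastAtMost)
  have 2: "density (lebesgue_n n) (\<lambda>y. ennreal (proposal_density A f \<kappa> n s x y)) = PiM {1..n} N"
  proof (rule PN.PiM_eqI)
    fix B assume B: "\<And>i. i \<in> {1..n} \<Longrightarrow> B i \<in> sets (N i)"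
    then have [measurable]: "\<And>i. i \<in> {1..n} \<Longrightarrow> B i \<in> sets borel"
      by (auto simp: N_def)
    have [measurable]: "Pi\<^sub>E {1..n} B \<in> sets (lebesgue_n n)"
      by (intro sets_PiM_I_finite) auto
    have [measurable]: "proposal_density A f \<kappa> n s x \<in> borel_measurable (lebesgue_n n)"
      unfolding proposal_density_def[abs_def] by measurable
    have "emeasure (density (lebesgue_n n) (\<lambda>y. ennreal (proposal_density A f \<kappa> n s x y)))
        (Pi\<^sub>E {1..n} B) =
        (\<integral>\<^sup>+y. ennreal (proposal_density A f \<kappa> n s x y) * indicator (Pi\<^sub>E {1..n} B) y \<partial>lebesgue_n n)"
      by (rule emeasure_density) measurable
    also have "\<dots> = (\<integral>\<^sup>+y. (\<Prod>i\<in>{1..n}. ennreal (normal_density (m i) s (y i)) * indicator (B i) (y i))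
        \<partial>lebesgue_n n)"
    proof (rule nn_integral_cong)
      fix y assume y: "y \<in> space (lebesgue_n n)"
      have "indicator (Pi\<^sub>E {1..n} B) y = (\<Prod>i\<in>{1..n}. indicator (B i) (y i) :: ennreal)"
      proof (cases "y \<in> Pi\<^sub>E {1..n} B")
        case True
        then have "(\<Prod>i\<in>{1..n}. indicator (B i) (y i) :: ennreal) = 1"
          by (intro prod.neutral) (auto simp: PiE_def Pi_def)
        with True show ?thesis by simp
      next
        case False
        then have "\<exists>j\<in>{1..n}. y j \<notin> B j"
          using y by (auto simp: space_PiM PiE_def Pi_def)
        then obtain j where "j \<in> {1..n}" "y j \<notin> B j"
          by blast
        then have "(\<Prod>i\<in>{1..n}. indicator (B i) (y i) :: ennreal) = 0"
          by (intro prod_zero bexI[of _ j]) auto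
        with False show ?thesis by simp
      qed
      then show "ennreal (proposal_density A f \<kappa> n s x y) * indicator (Pi\<^sub>E {1..n} B) y =
          (\<Prod>i\<in>{1..n}. ennreal (normal_density (m i) s (y i)) * indicator (B i) (y i))"
        by (simp add: proposal_density_def m_def prod.distrib prod_ennreal)
    qed
    also have "\<dots> = (\<Prod>i\<in>{1..n}. \<integral>\<^sup>+t. ennreal (normal_density (m i) s t) * indicator (B i) t \<partial>lborel)"
      by (rule L.product_nn_integral_prod) auto
    also have "\<dots> = (\<Prod>i\<in>{1..n}. emeasure (N i) (B i))"
      unfolding N_def by (intro prod.cong refl emeasure_density[symmetric]) auto
    finally show "emeasure (density (lebesgue_n n) (\<lambda>y. ennreal (proposal_density A f \<kappa> n s x y)))
        (Pi\<^sub>E {1..n} B) = (\<Prod>i\<in>{1..n}. emeasure (N i) (B i))" .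
  qed (simp_all only: sets_N sets_distr sets_density finite_atLeastAtMost)
  show ?thesis
    unfolding 1 2 ..
qed

end

theory Submission
  imports Defs "HOL-Real_Asymp.Real_Asymp"
begin

text \<open>
  Since \<open>\<phi>\<close> is bounded by \<open>M\<close>, replacing the target by the product reference law changes the mean
  acceptance at most by the factor \<open>exp (3 * M)\<close>. For the product law the log acceptance ratio is a sum of
  independent terms \<open>T\<close>, one for each coordinate, with relative step \<open>h = s / \<lambda>\<close>. Let \<open>P\<close> be
  the product of the Hellinger affinities \<open>E exp (T / 2)\<close>. From \<open>min 1 (exp t) \<le> exp (t / 2)\<close>
  the mean acceptance is at most \<open>P\<close>, and from AM-GM and \<open>E exp T = 1\<close> it is at least \<open>P\<^sup>2 / 2\<close>,
  so the theorem reduces to sharp two-sided bounds for a one-dimensional affinity.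

  Here \<open>2 - 2 * E exp (T / 2) = E (1 - exp (T / 2))\<^sup>2\<close>, which reversibility bounds by
  \<open>E T\<^sup>2\<close> without any computation of the mean of \<open>T\<close>. By Taylor expansion (a trapezoidal rule error
  for SLA) \<open>T\<close> has order \<open>h\<close> for RWM and \<open>h ^ 3\<close> for SLA, so the affinity is
  \<open>1 - O(h ^ 2)\<close> resp. \<open>1 - O(h ^ 6)\<close>. The order is sharp by Fatou's lemma: the leading
  coefficient of \<open>T\<close> vanishes identically only for affine \<open>g\<close>, and then \<open>exp (- g)\<close> is not
  a probability density.
\<close>

section \<open>Reversibility and Hellinger affinity in one dimension\<close>

text \<open>Proposal mean of one coordinate in units of its scale: \<open>u\<close> stands for x_i /
  lambda_i and \<open>h\<close> for the relative step s / lambda_i, so that the scale itself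
  disappears.\<close>

fun drift_mean :: "algorithm \<Rightarrow> (real \<Rightarrow> real) \<Rightarrow> real \<Rightarrow> real \<Rightarrow> real" where
  "drift_mean RWM g h u = u"
| "drift_mean SLA g h u = u - h\<^sup>2 / 2 * deriv g u"

text \<open>Logarithm of pi(v) q(v,u) / (pi(u) q(u,v)) for pi = exp(-g). Both Gaussian densities
  have standard deviation \<open>h\<close>, so their normalising constants cancel.\<close>

definition log_ratio :: "algorithm \<Rightarrow> (real \<Rightarrow> real) \<Rightarrow> real \<Rightarrow> real \<Rightarrow> real \<Rightarrow> real" where
  "log_ratio A g h u v =
     g u - g v + ((v - drift_mean A g h u)\<^sup>2 - (u - drift_mean A g h v)\<^sup>2) / (2 * h\<^sup>2)"

text \<open>Mean of F(state, proposal) for a stationary state. Values in \<open>ennreal\<close>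
  postpone integrability questions, and the explicit noise \<open>z\<close> lets bounds in
  \<open>u\<close> and \<open>z\<close> be used directly.\<close>

definition step_integral ::
    "algorithm \<Rightarrow> (real \<Rightarrow> real) \<Rightarrow> real \<Rightarrow> (real \<Rightarrow> real \<Rightarrow> ennreal) \<Rightarrow> ennreal" where
  "step_integral A g h F =
     (\<integral>\<^sup>+u. \<integral>\<^sup>+z. F u (drift_mean A g h u + h * z)
        \<partial>density lborel std_normal_density \<partial>density lborel (\<lambda>u. exp (- g u)))"

text \<open>As the exponential of \<open>log_ratio\<close> is the density of the time-reversed law
  of (state, proposal), this is the Hellinger affinity of that law with the original one. For
  \<open>h > 0\<close>, \<open>ennreal_affinity\<close> shows that \<open>enn2real\<close> loses
  nothing.\<close>

definition affinity :: "algorithm \<Rightarrow> (real \<Rightarrow> real) \<Rightarrow> real \<Rightarrow> real" where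
  "affinity A g h = enn2real (step_integral A g h (\<lambda>u v. ennreal (exp (log_ratio A g h u v / 2))))"

locale smooth_density =
  fixes g :: "real \<Rightarrow> real"
  assumes smooth: "infinitely_differentiable g"
    and poly_bounded: "polynomially_bounded ((deriv ^^ k) g)"
    and prob: "prob_space (density lborel (\<lambda>x. ennreal (exp (- g x))))"
    and moments: "integrable lborel (\<lambda>x. x ^ k * exp (- g x))"
begin

section \<open>Differentiability and measurability of the one-dimensional ingredients\<close>

lemma DERIV_iterate [derivative_intros]:
  "((deriv ^^ k) g has_real_derivative (deriv ^^ Suc k) g x) (at x within S)"
  using smooth unfolding infinitely_differentiable_def
  by (auto simp: DERIV_deriv_iff_real_differentiable intro: has_field_derivative_at_within)

lemma isCont_iterate: "isCont ((deriv ^^ k) g) x"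
  by (rule DERIV_isCont[OF DERIV_iterate])

lemma measurable_iterate [measurable]: "(deriv ^^ k) g \<in> borel_measurable borel"
  by (intro borel_measurable_continuous_onI continuous_at_imp_continuous_on ballI isCont_iterate)

lemma measurable_g [measurable]: "g \<in> borel_measurable borel"
  and measurable_deriv [measurable]: "deriv g \<in> borel_measurable borel"
  using measurable_iterate[of 0] measurable_iterate[of 1] by simp_all

lemma measurable_drift_mean [measurable]: "drift_mean A g h \<in> borel_measurable borel"
proof -
  have "drift_mean SLA g h = (\<lambda>u. u - h\<^sup>2 / 2 * deriv g u)" "drift_mean RWM g h = (\<lambda>u. u)"
    by auto
  then show ?thesis by (cases A) simp_all
qed

lemma measurable_proposal_density [measurable]:
  "(\<lambda>(u, v). normal_density (drift_mean A g h u) h v) \<in> borel_measurable (borel \<Otimes>\<^sub>M borel)"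
  unfolding normal_density_def by measurable

lemma measurable_log_ratio [measurable]:
  "(\<lambda>(u, v). log_ratio A g h u v) \<in> borel_measurable (borel \<Otimes>\<^sub>M borel)"
  unfolding log_ratio_def by measurable

lemma log_ratio_swap: "log_ratio A g h v u = - log_ratio A g h u v"
  by (simp add: log_ratio_def diff_divide_distrib)

text \<open>Substituting v = m(u) + h z, with Jacobian \<open>h\<close>, replaces the noise by the
  proposal. Both variables are then integrated against Lebesgue measure and can be
  exchanged.\<close>

lemma step_integral_lebesgue:
  assumes F [measurable]: "case_prod F \<in> borel_measurable (borel \<Otimes>\<^sub>M borel)" and h: "h > 0"
  shows "step_integral A g h F =
    (\<integral>\<^sup>+u. \<integral>\<^sup>+v. ennreal (exp (- g u) * normal_density (drift_mean A g h u) h v) * F u v \<partial>lborel \<partial>lborel)"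
proof -
  have "(\<integral>\<^sup>+z. F u (drift_mean A g h u + h * z) \<partial>density lborel std_normal_density) =
      (\<integral>\<^sup>+v. ennreal (normal_density (drift_mean A g h u) h v) * F u v \<partial>lborel)" for u
  proof -
    have "ennreal h * ennreal (normal_density (drift_mean A g h u) h (drift_mean A g h u + h * z)) =
        ennreal (std_normal_density z)" for z
      using h by (subst ennreal_mult[symmetric])
        (auto simp: normal_density_def power_mult_distrib real_sqrt_mult)
    then show ?thesis
      using h by (subst nn_integral_real_affine[where c = h and t = "drift_mean A g h u"])
        (auto simp: nn_integral_density nn_integral_cmult[symmetric] mult.assoc[symmetric])
  qed
  then show ?thesis
    unfolding step_integral_def
    by (subst nn_integral_density)
      (simp_all add: nn_integral_density ennreal_mult nn_integral_cmult[symmetric] mult.assoc)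
qed

text \<open>\<open>log_ratio\<close> is the difference of the exponents of the two joint densities,
  so only the common Gaussian constant has to be carried along.\<close>

lemma detailed_balance:
  assumes h: "h > 0"
  shows "exp (log_ratio A g h u v) * (exp (- g u) * normal_density (drift_mean A g h u) h v) =
    exp (- g v) * normal_density (drift_mean A g h v) h u"
proof -
  \<comment> \<open>\<open>c\<close> will be the normalising constant of the Gaussian density, the
    same on both sides.\<close>
  have scale: "e * (a * (c * b)) = a' * (c * b')" if "e * (a * b) = a' * b'" for e a b c a' b' :: real
    using arg_cong[OF that, of "(*) c"] by (simp add: ac_simps)
  have "log_ratio A g h u v + (- g u + - (v - drift_mean A g h u)\<^sup>2 / (2 * h\<^sup>2)) =
      - g v + - (u - drift_mean A g h v)\<^sup>2 / (2 * h\<^sup>2)"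
    by (simp add: log_ratio_def diff_divide_distrib)
  then have "exp (log_ratio A g h u v) *
      (exp (- g u) * exp (- (v - drift_mean A g h u)\<^sup>2 / (2 * h\<^sup>2))) =
      exp (- g v) * exp (- (u - drift_mean A g h v)\<^sup>2 / (2 * h\<^sup>2))"
    by (simp only: exp_add[symmetric])
  then show ?thesis
    unfolding normal_density_def by (rule scale)
qed

text \<open>The weight exp T turns the density of (u, v) into that of (v, u), and Tonelli's theorem
  exchanges the variables. This is the device for removing a weight exp T.\<close>

lemma step_integral_swap:
  assumes F [measurable]: "case_prod F \<in> borel_measurable (borel \<Otimes>\<^sub>M borel)" and h: "h > 0"
  shows "step_integral A g h (\<lambda>u v. ennreal (exp (log_ratio A g h u v)) * F u v) =
    step_integral A g h (\<lambda>u v. F v u)"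
proof -
  let ?w = "\<lambda>u v. ennreal (exp (- g u) * normal_density (drift_mean A g h u) h v)"
  have F' [measurable]: "(\<lambda>(u, v). F v u) \<in> borel_measurable (borel \<Otimes>\<^sub>M borel)"
    using measurable_pair_swap[OF F] by (simp add: case_prod_beta')
  have w: "?w u v * (ennreal (exp (log_ratio A g h u v)) * F u v) = ?w v u * F u v" for u v
  proof -
    have "?w u v * ennreal (exp (log_ratio A g h u v)) = ?w v u"
      unfolding detailed_balance[OF h, of A u v, symmetric]
      by (subst ennreal_mult''[symmetric]) (simp_all add: mult.commute)
    then show ?thesis by (simp only: mult.assoc[symmetric])
  qed
  have "step_integral A g h (\<lambda>u v. ennreal (exp (log_ratio A g h u v)) * F u v) =
      (\<integral>\<^sup>+u. \<integral>\<^sup>+v. ?w v u * F u v \<partial>lborel \<partial>lborel)"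
    by (subst step_integral_lebesgue[OF _ h]) (simp_all only: w, measurable)
  also have "\<dots> = (\<integral>\<^sup>+u. \<integral>\<^sup>+v. ?w u v * F v u \<partial>lborel \<partial>lborel)"
    by (rule lborel_pair.Fubini') measurable
  also have "\<dots> = step_integral A g h (\<lambda>u v. F v u)"
    by (subst step_integral_lebesgue[OF _ h]) simp_all
  finally show ?thesis .
qed

section \<open>Expectations under one stationary step\<close>

lemma step_integral_const: "step_integral A g h (\<lambda>u v. c) = c"
proof -
  interpret M: prob_space "density lborel (\<lambda>x. ennreal (exp (- g x)))" by (rule prob)
  interpret N: prob_space "density lborel std_normal_density"
    by (rule prob_space_normal_density) simp
  show ?thesis
    using M.emeasure_space_1 N.emeasure_space_1 by (simp add: step_integral_def)
qed

lemma sigma_finite_normal: "sigma_finite_measure (density lborel std_normal_density)"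
proof -
  interpret N: prob_space "density lborel std_normal_density"
    by (rule prob_space_normal_density) simp
  show ?thesis ..
qed

lemma step_integral_mono:
  "(\<And>u z. F u (drift_mean A g h u + h * z) \<le> G u (drift_mean A g h u + h * z))
    \<Longrightarrow> step_integral A g h F \<le> step_integral A g h G"
  unfolding step_integral_def by (intro nn_integral_mono)

lemma step_integral_add:
  assumes [measurable]: "case_prod F \<in> borel_measurable (borel \<Otimes>\<^sub>M borel)"
    "case_prod G \<in> borel_measurable (borel \<Otimes>\<^sub>M borel)"
  shows "step_integral A g h (\<lambda>u v. F u v + G u v) = step_integral A g h F + step_integral A g h G"
proof -
  interpret sigma_finite_measure "density lborel std_normal_density" by (rule sigma_finite_normal)
  show ?thesis
    unfolding step_integral_def by (simp add: nn_integral_add)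
qed

lemma step_integral_cmult:
  assumes [measurable]: "case_prod F \<in> borel_measurable (borel \<Otimes>\<^sub>M borel)"
  shows "step_integral A g h (\<lambda>u v. c * F u v) = c * step_integral A g h F"
proof -
  interpret sigma_finite_measure "density lborel std_normal_density" by (rule sigma_finite_normal)
  show ?thesis
    unfolding step_integral_def by (simp add: nn_integral_cmult)
qed

lemma step_integral_exp_log_ratio:
  "h > 0 \<Longrightarrow> step_integral A g h (\<lambda>u v. ennreal (exp (log_ratio A g h u v))) = 1"
  using step_integral_swap[of "\<lambda>_ _. 1" h A] by (simp add: step_integral_const)

text \<open>Expand the square and use E exp T = 1. The identity is stated as a sum because
  subtraction in \<open>ennreal\<close> is truncated.\<close>

lemma hellinger:
  assumes h: "h > 0"
  shows "step_integral A g h (\<lambda>u v. ennreal ((1 - exp (log_ratio A g h u v / 2))\<^sup>2)) +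
    2 * step_integral A g h (\<lambda>u v. ennreal (exp (log_ratio A g h u v / 2))) = 2"
proof -
  let ?T = "log_ratio A g h"
  have "ennreal ((1 - exp (t / 2))\<^sup>2) + 2 * ennreal (exp (t / 2)) = 1 + ennreal (exp t)" for t
  proof -
    have "(1 - exp (t / 2))\<^sup>2 + 2 * exp (t / 2) = 1 + (exp (t / 2))\<^sup>2"
      by (simp add: power2_eq_square algebra_simps)
    also have "(exp (t / 2))\<^sup>2 = exp t"
      by (simp add: exp_double[symmetric])
    finally have "ennreal ((1 - exp (t / 2))\<^sup>2 + 2 * exp (t / 2)) = ennreal (1 + exp t)"
      by simp
    then show ?thesis
      by (simp add: ennreal_mult')
  qed
  then have "step_integral A g h (\<lambda>u v. ennreal ((1 - exp (?T u v / 2))\<^sup>2) +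
      2 * ennreal (exp (?T u v / 2))) = step_integral A g h (\<lambda>u v. 1 + ennreal (exp (?T u v)))"
    by simp
  also have "\<dots> = 2"
    by (subst step_integral_add) (simp_all add: step_integral_const step_integral_exp_log_ratio[OF h])
  finally show ?thesis
    by (subst (asm) step_integral_add) (simp_all add: step_integral_cmult)
qed

lemma affinity_nonneg: "affinity A g h \<ge> 0"
  by (simp add: affinity_def)

lemma ennreal_affinity:
  assumes h: "h > 0"
  shows "step_integral A g h (\<lambda>u v. ennreal (exp (log_ratio A g h u v / 2))) =
    ennreal (affinity A g h)"
proof -
  have "step_integral A g h (\<lambda>u v. ennreal (exp (log_ratio A g h u v / 2))) \<noteq> \<infinity>"
    using hellinger[OF h, of A] by (auto simp: ennreal_mult_top)
  then show ?thesis
    by (simp add: affinity_def less_top)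
qed

lemma hellinger_affinity:
  assumes h: "h > 0"
  shows "step_integral A g h (\<lambda>u v. ennreal ((1 - exp (log_ratio A g h u v / 2))\<^sup>2)) =
      ennreal (2 - 2 * affinity A g h)" and "affinity A g h \<le> 1"
proof -
  let ?H = "step_integral A g h (\<lambda>u v. ennreal ((1 - exp (log_ratio A g h u v / 2))\<^sup>2))"
  have eq: "?H + ennreal (2 * affinity A g h) = ennreal 2"
    using hellinger[OF h, of A] by (simp add: ennreal_affinity[OF h] ennreal_mult' affinity_nonneg)
  then have "?H \<noteq> \<infinity>" by auto
  then obtain r where r: "r \<ge> 0" "?H = ennreal r" by (cases ?H) auto
  with eq have "ennreal (r + 2 * affinity A g h) = ennreal 2"
    by (simp add: affinity_nonneg)
  then have "r + 2 * affinity A g h = 2"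
    using r affinity_nonneg[of A h] by (subst (asm) ennreal_inj) auto
  with r show "?H = ennreal (2 - 2 * affinity A g h)" "affinity A g h \<le> 1"
    by (auto simp: algebra_simps)
qed

text \<open>For \<open>t \<le> 0\<close> the inequality exp s >= 1 + s yields the first term; for
  \<open>t > 0\<close>, factoring out \<open>exp t\<close> reduces to \<open>- t\<close> and yields
  the second, whose weight \<open>step_integral_swap\<close> can remove.\<close>

lemma one_minus_exp_half_sq_le: "(1 - exp (t / 2))\<^sup>2 \<le> t\<^sup>2 / 4 + exp t * (t\<^sup>2 / 4)" for t :: real
proof -
  have neg: "(1 - exp (s / 2))\<^sup>2 \<le> s\<^sup>2 / 4" if "s \<le> 0" for s :: real
  proof -
    have "0 \<le> 1 - exp (s / 2)" "1 - exp (s / 2) \<le> - s / 2"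
      using that exp_ge_add_one_self[of "s / 2"] by (auto simp del: exp_ge_add_one_self)
    then have "(1 - exp (s / 2))\<^sup>2 \<le> (- s / 2)\<^sup>2" by (intro power_mono)
    then show ?thesis by (simp add: power_divide)
  qed
  show ?thesis
  proof (cases "t \<le> 0")
    case True
    then show ?thesis using neg[of t] by (smt (verit) exp_gt_zero mult_nonneg_nonneg zero_le_power2 divide_nonneg_nonneg)
  next
    case False
    have "(1 - exp (t / 2))\<^sup>2 = exp t * (1 - exp (- t / 2))\<^sup>2"
    proof -
      have "exp t = (exp (t / 2))\<^sup>2" by (simp add: exp_double[symmetric])
      moreover have "exp (t / 2) * (1 - exp (- t / 2)) = exp (t / 2) - 1"
        by (simp add: algebra_simps mult_exp_exp)
      ultimately show ?thesis
        by (metis power2_commute power_mult_distrib)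
    qed
    also have "\<dots> \<le> exp t * (t\<^sup>2 / 4)"
      using neg[of "- t"] False by (intro mult_left_mono) auto
    finally show ?thesis by (smt (verit) zero_le_power2 divide_nonneg_nonneg)
  qed
qed

text \<open>The pointwise bound leaves T^2 / 4 and exp T times T^2 / 4. Reversal turns the second
  into the first because T is antisymmetric. The constant is not optimised.\<close>

lemma one_minus_affinity_le:
  assumes h: "h > 0"
  shows "ennreal (1 - affinity A g h) \<le>
    step_integral A g h (\<lambda>u v. ennreal ((log_ratio A g h u v)\<^sup>2))"
proof -
  let ?T = "log_ratio A g h"
  let ?Q = "\<lambda>u v. ennreal ((?T u v)\<^sup>2 / 4)"
  have "ennreal (2 - 2 * affinity A g h) \<le>
      step_integral A g h (\<lambda>u v. ?Q u v + ennreal (exp (?T u v)) * ?Q u v)"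
    unfolding hellinger_affinity(1)[OF h, symmetric]
    using one_minus_exp_half_sq_le
    by (intro step_integral_mono) (simp add: ennreal_plus[symmetric] ennreal_mult'[symmetric] ennreal_leI del: ennreal_plus)
  also have "\<dots> = step_integral A g h ?Q + step_integral A g h (\<lambda>u v. ?Q v u)"
    by (subst step_integral_add) (simp_all add: step_integral_swap[OF _ h])
  also have "\<dots> = step_integral A g h (\<lambda>u v. ?Q u v + ?Q v u)"
    by (subst step_integral_add) simp_all
  also have "\<dots> \<le> step_integral A g h (\<lambda>u v. ennreal ((?T u v)\<^sup>2))"
  proof (rule step_integral_mono)
    fix u z
    let ?v = "drift_mean A g h u + h * z"
    show "?Q u ?v + ?Q ?v u \<le> ennreal ((?T u ?v)\<^sup>2)"
      unfolding log_ratio_swap[of A h ?v u]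
      by (simp add: ennreal_plus[symmetric] ennreal_leI del: ennreal_plus)
  qed
  finally have "ennreal (2 - 2 * affinity A g h) \<le>
      step_integral A g h (\<lambda>u v. ennreal ((?T u v)\<^sup>2))" .
  moreover have "ennreal (1 - affinity A g h) \<le> ennreal (2 - 2 * affinity A g h)"
    using hellinger_affinity(2)[OF h, of A] by (intro ennreal_leI) simp
  ultimately show ?thesis by (rule order_trans[rotated])
qed

end

section \<open>Order of the log acceptance ratio\<close>

text \<open>Power of \<open>h\<close> carried by \<open>log_ratio\<close>. One minus the affinity
  has twice this order, and \<open>critical_exponent\<close> is its reciprocal.\<close>

fun scaling_order :: "algorithm \<Rightarrow> nat" where
  "scaling_order RWM = 1"
| "scaling_order SLA = 3"

text \<open>Polynomial growth in \<open>u\<close> and \<open>z\<close>, uniformly for steps in (0,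
  1]. A single base that is at least 1 lets different exponents be merged, and its powers split into
  a moment of \<open>u\<close> and a moment of \<open>z\<close>.\<close>

definition tame :: "(real \<Rightarrow> real \<Rightarrow> real \<Rightarrow> real) \<Rightarrow> bool" where
  "tame F \<longleftrightarrow> (\<exists>K N. K \<ge> 0 \<and> (\<forall>h u z. 0 < h \<longrightarrow> h \<le> 1 \<longrightarrow>
     \<bar>F h u z\<bar> \<le> K * ((1 + \<bar>u\<bar>) * (1 + \<bar>z\<bar>)) ^ N))"

section \<open>Closure rules for uniform polynomial growth\<close>

lemma tame_base_ge_1: "(1::real) \<le> (1 + \<bar>u\<bar>) * (1 + \<bar>z\<bar>)"
  by (smt (verit) mult_less_cancel_left2 mult_left_le mult_cancel_left1 abs_ge_zero mult_nonneg_nonneg distrib_left distrib_right mult_1 mult_1_right)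

lemma tameI:
  assumes "\<And>h u z. 0 < h \<Longrightarrow> h \<le> 1 \<Longrightarrow> \<bar>F h u z\<bar> \<le> K * ((1 + \<bar>u\<bar>) * (1 + \<bar>z\<bar>)) ^ N"
  shows "tame F"
proof -
  have "\<bar>F h u z\<bar> \<le> \<bar>K\<bar> * ((1 + \<bar>u\<bar>) * (1 + \<bar>z\<bar>)) ^ N" if "0 < h" "h \<le> 1" for h u z
    by (rule order_trans[OF assms[OF that]]) (intro mult_right_mono, auto)
  then show ?thesis
    unfolding tame_def by (intro exI[of _ "\<bar>K\<bar>"] exI[of _ N]) auto
qed

lemma tameE:
  assumes "tame F"
  obtains K N where "K \<ge> 0"
    "\<And>h u z. 0 < h \<Longrightarrow> h \<le> 1 \<Longrightarrow> \<bar>F h u z\<bar> \<le> K * ((1 + \<bar>u\<bar>) * (1 + \<bar>z\<bar>)) ^ N"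
  using assms unfolding tame_def by blast

lemma tame_mono:
  assumes "tame G" "\<And>h u z. 0 < h \<Longrightarrow> h \<le> 1 \<Longrightarrow> \<bar>F h u z\<bar> \<le> \<bar>G h u z\<bar>"
  shows "tame F"
  using assms(1) by (rule tameE) (rule tameI, rule order_trans[OF assms(2)], auto)

lemma tame_const: "tame (\<lambda>h u z. c)"
  by (rule tameI[of _ "\<bar>c\<bar>" 0]) simp

lemma tame_h: "tame (\<lambda>h u z. h)"
  by (rule tameI[of _ 1 0]) simp

lemma tame_u: "tame (\<lambda>h u z. u)"
proof (rule tameI[of _ 1 1])
  fix u z :: real
  have "0 \<le> (1 + \<bar>u\<bar>) * \<bar>z\<bar>" by simp
  then show "\<bar>u\<bar> \<le> 1 * ((1 + \<bar>u\<bar>) * (1 + \<bar>z\<bar>)) ^ 1" by (simp add: algebra_simps)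
qed

lemma tame_z: "tame (\<lambda>h u z. z)"
proof (rule tameI[of _ 1 1])
  fix u z :: real
  have "0 \<le> \<bar>u\<bar> * (1 + \<bar>z\<bar>)" by simp
  then show "\<bar>z\<bar> \<le> 1 * ((1 + \<bar>u\<bar>) * (1 + \<bar>z\<bar>)) ^ 1" by (simp add: algebra_simps)
qed

lemma tame_mult:
  assumes "tame F" "tame G"
  shows "tame (\<lambda>h u z. F h u z * G h u z)"
proof -
  obtain K N where K: "K \<ge> 0"
    "\<And>h u z. 0 < h \<Longrightarrow> h \<le> 1 \<Longrightarrow> \<bar>F h u z\<bar> \<le> K * ((1 + \<bar>u\<bar>) * (1 + \<bar>z\<bar>)) ^ N"
    using assms(1) unfolding tame_def by blast
  obtain L P where L: "L \<ge> 0"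
    "\<And>h u z. 0 < h \<Longrightarrow> h \<le> 1 \<Longrightarrow> \<bar>G h u z\<bar> \<le> L * ((1 + \<bar>u\<bar>) * (1 + \<bar>z\<bar>)) ^ P"
    using assms(2) unfolding tame_def by blast
  show ?thesis
  proof (rule tameI)
    fix h u z :: real assume h: "0 < h" "h \<le> 1"
    have "\<bar>F h u z * G h u z\<bar> \<le>
        (K * ((1 + \<bar>u\<bar>) * (1 + \<bar>z\<bar>)) ^ N) * (L * ((1 + \<bar>u\<bar>) * (1 + \<bar>z\<bar>)) ^ P)"
      unfolding abs_mult using K L h by (intro mult_mono) auto
    then show "\<bar>F h u z * G h u z\<bar> \<le> (K * L) * ((1 + \<bar>u\<bar>) * (1 + \<bar>z\<bar>)) ^ (N + P)"
      by (simp add: power_add mult_ac)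
  qed
qed

lemma tame_add:
  assumes "tame F" "tame G"
  shows "tame (\<lambda>h u z. F h u z + G h u z)"
proof -
  obtain K N where K: "K \<ge> 0"
    "\<And>h u z. 0 < h \<Longrightarrow> h \<le> 1 \<Longrightarrow> \<bar>F h u z\<bar> \<le> K * ((1 + \<bar>u\<bar>) * (1 + \<bar>z\<bar>)) ^ N"
    using assms(1) unfolding tame_def by blast
  obtain L P where L: "L \<ge> 0"
    "\<And>h u z. 0 < h \<Longrightarrow> h \<le> 1 \<Longrightarrow> \<bar>G h u z\<bar> \<le> L * ((1 + \<bar>u\<bar>) * (1 + \<bar>z\<bar>)) ^ P"
    using assms(2) unfolding tame_def by blast
  show ?thesis
  proof (rule tameI)
    fix h u z :: real assume h: "0 < h" "h \<le> 1"
    let ?B = "(1 + \<bar>u\<bar>) * (1 + \<bar>z\<bar>)"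
    have "K * ?B ^ N \<le> K * ?B ^ (N + P)" "L * ?B ^ P \<le> L * ?B ^ (N + P)"
      using tame_base_ge_1[of u z] K(1) L(1)
      by (auto intro!: mult_left_mono power_increasing simp del: zero_le_mult_iff)
    then show "\<bar>F h u z + G h u z\<bar> \<le> (K + L) * ?B ^ (N + P)"
      using K(2)[OF h, of u z] L(2)[OF h, of u z] unfolding distrib_right by linarith
  qed
qed

lemma tame_minus: "tame F \<Longrightarrow> tame (\<lambda>h u z. - F h u z)"
  by (rule tame_mono) auto

lemma tame_diff: "tame F \<Longrightarrow> tame G \<Longrightarrow> tame (\<lambda>h u z. F h u z - G h u z)"
  using tame_add[OF _ tame_minus] by simp

lemma tame_power: "tame F \<Longrightarrow> tame (\<lambda>h u z. F h u z ^ n)"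
  by (induction n) (auto intro: tame_const tame_mult)

lemma tame_divide: "tame F \<Longrightarrow> tame (\<lambda>h u z. F h u z / c)"
  using tame_mult[OF _ tame_const, of F "inverse c"] by (simp add: field_class.field_divide_inverse)

lemma tame_abs: "tame F \<Longrightarrow> tame (\<lambda>h u z. \<bar>F h u z\<bar>)"
  by (rule tame_mono) auto

lemmas tame_intros = tame_const tame_h tame_u tame_z tame_mult tame_add tame_minus tame_diff
  tame_power tame_divide tame_abs

lemma tame_poly_bounded:
  assumes p: "polynomially_bounded p" and F: "tame F"
  shows "tame (\<lambda>h u z. p (F h u z))"
proof -
  obtain P :: "real poly" where P: "\<And>x. \<bar>p x\<bar> \<le> poly P x"
    using p unfolding polynomially_bounded_def by blast
  have "tame (\<lambda>h u z. poly P (F h u z))"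
    by (induction P) (auto intro!: tame_intros F)
  then show ?thesis
    by (rule tame_mono) (use P in \<open>smt (verit)\<close>)
qed

text \<open>Meant for intermediate points of Taylor expansions, of which only the distance from the
  base point is controlled.\<close>

lemma tame_near:
  assumes "tame X" "tame Y" "\<And>h u z. 0 < h \<Longrightarrow> h \<le> 1 \<Longrightarrow> \<bar>F h u z - X h u z\<bar> \<le> \<bar>Y h u z\<bar>"
  shows "tame F"
proof (rule tame_mono)
  show "tame (\<lambda>h u z. \<bar>X h u z\<bar> + \<bar>Y h u z\<bar>)"
    by (intro tame_intros assms(1,2))
  fix h u z :: real assume "0 < h" "h \<le> 1"
  then show "\<bar>F h u z\<bar> \<le> \<bar>\<bar>X h u z\<bar> + \<bar>Y h u z\<bar>\<bar>"
    using assms(3)[of h u z] by linarith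
qed

section \<open>Finite polynomial moments\<close>

lemma integrable_poly_weight:
  fixes w :: "real \<Rightarrow> real"
  assumes "\<And>k. integrable lborel (\<lambda>x. x ^ k * w x)"
  shows "integrable lborel (\<lambda>x. poly P x * w x)"
proof -
  have "integrable lborel (\<lambda>x. \<Sum>i\<le>degree P. coeff P i * (x ^ i * w x))"
    by (intro Bochner_Integration.integrable_sum integrable_mult_right assms)
  then show ?thesis
    by (simp add: poly_altdef sum_distrib_right mult.assoc)
qed

text \<open>(1 + |x|)^2 is at most 2 + 2 x^2, so an even power of 1 + |x| lies below a polynomial
  free of absolute values, to which the moment assumption applies.\<close>

lemma nn_integral_moment_finite:
  fixes w :: "real \<Rightarrow> real"
  assumes "\<And>k. integrable lborel (\<lambda>x. x ^ k * w x)" and w: "\<And>x. w x \<ge> 0"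
  shows "(\<integral>\<^sup>+x. ennreal (w x * (1 + \<bar>x\<bar>) ^ (2 * n)) \<partial>lborel) < \<infinity>"
proof -
  have "(1 + \<bar>x\<bar>)\<^sup>2 \<le> 2 + 2 * x\<^sup>2" for x :: real
    using sum_squares_ge_zero[of "1 - \<bar>x\<bar>" 0] by (simp add: power2_eq_square algebra_simps)
  then have "((1 + \<bar>x\<bar>)\<^sup>2) ^ n \<le> (2 + 2 * x\<^sup>2) ^ n" for x :: real
    by (intro power_mono) auto
  moreover have "poly ([:2, 0, 2:] ^ n) x = (2 + 2 * x\<^sup>2) ^ n" for x :: real
    by (simp add: power2_eq_square mult_ac)
  ultimately have le: "(1 + \<bar>x\<bar>) ^ (2 * n) \<le> poly ([:2, 0, 2:] ^ n) x" for x :: real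
    by (simp only: power_mult)
  have "(\<integral>\<^sup>+x. ennreal (w x * (1 + \<bar>x\<bar>) ^ (2 * n)) \<partial>lborel) \<le>
      (\<integral>\<^sup>+x. ennreal (norm (poly ([:2, 0, 2:] ^ n) x * w x)) \<partial>lborel)"
  proof (intro nn_integral_mono ennreal_leI)
    fix x
    have "w x * (1 + \<bar>x\<bar>) ^ (2 * n) \<le> w x * poly ([:2, 0, 2:] ^ n) x"
      by (intro mult_left_mono le w)
    then show "w x * (1 + \<bar>x\<bar>) ^ (2 * n) \<le> norm (poly ([:2, 0, 2:] ^ n) x * w x)"
      unfolding mult.commute[of "w x"] real_norm_def by (rule order_trans[OF _ abs_ge_self])
  qed
  also have "\<dots> < \<infinity>"
    using integrable_poly_weight[OF assms(1)] unfolding integrable_iff_bounded by blast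
  finally show ?thesis .
qed

context smooth_density
begin

section \<open>Taylor expansion of the log acceptance ratio\<close>

abbreviation D :: "nat \<Rightarrow> real \<Rightarrow> real" where "D k \<equiv> (deriv ^^ k) g"

text \<open>Lagrange's remainder, with the intermediate point chosen once and for all as a function
  of \<open>u\<close> and \<open>d\<close>. Inserting a \<open>d\<close> that depends on h, u and z
  then gives a function to which the \<open>tame\<close> rules apply.\<close>

lemma taylor:
  "\<exists>\<xi>. \<forall>u d. \<bar>\<xi> u d - u\<bar> \<le> \<bar>d\<bar> \<and>
     D k (u + d) = (\<Sum>m<n. D (k + m) u / fact m * d ^ m) + D (k + n) (\<xi> u d) / fact n * d ^ n"
proof -
  have "\<exists>\<xi>. \<bar>\<xi> - u\<bar> \<le> \<bar>d\<bar> \<and>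
     D k (u + d) = (\<Sum>m<n. D (k + m) u / fact m * d ^ m) + D (k + n) \<xi> / fact n * d ^ n" for u d
  proof -
    have "((\<lambda>t. D (k + m) (u + t)) has_real_derivative D (k + Suc m) (u + x)) (at x)" for m x
      by (rule DERIV_chain2[where g = "\<lambda>t. u + t", OF DERIV_iterate, THEN DERIV_cong])
        (auto intro!: derivative_eq_intros)
    then obtain t where "\<bar>t\<bar> \<le> \<bar>d\<bar>" "D k (u + d) =
        (\<Sum>m<n. D (k + m) (u + 0) / fact m * d ^ m) + D (k + n) (u + t) / fact n * d ^ n"
      using Maclaurin_all_le[of "\<lambda>m t. D (k + m) (u + t)" "\<lambda>t. D k (u + t)" d n] by fastforce
    then show ?thesis by (intro exI[of _ "u + t"]) simp
  qed
  then have "\<forall>u d. \<exists>\<xi>. \<bar>\<xi> - u\<bar> \<le> \<bar>d\<bar> \<and>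
     D k (u + d) = (\<Sum>m<n. D (k + m) u / fact m * d ^ m) + D (k + n) \<xi> / fact n * d ^ n"
    by (intro allI)
  then show ?thesis by (simp only: choice_iff)
qed

text \<open>Coefficient of \<open>h ^ scaling_order A\<close> in the log ratio at fixed
  \<open>u\<close> and \<open>z\<close>.\<close>

fun leading_term :: "algorithm \<Rightarrow> real \<Rightarrow> real \<Rightarrow> real" where
  "leading_term RWM u z = - z * D 1 u"
| "leading_term SLA u z = z ^ 3 * D 3 u / 12 - z * D 1 u * D 2 u / 4"

definition scaled_log_ratio :: "algorithm \<Rightarrow> real \<Rightarrow> real \<Rightarrow> real \<Rightarrow> real" where
  "scaled_log_ratio A h u z = log_ratio A g h u (drift_mean A g h u + h * z) / h ^ scaling_order A"

text \<open>Expanding the squares cancels \<open>(v - u)\<^sup>2\<close>. What remains is the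
  trapezoidal rule error for g' between u and v, and a difference of squared gradients with a factor
  of order h^2.\<close>

lemma log_ratio_SLA:
  "h \<noteq> 0 \<Longrightarrow> log_ratio SLA g h u v =
    g u - g v + (v - u) * (D 1 u + D 1 v) / 2 - h\<^sup>2 / 8 * ((D 1 v)\<^sup>2 - (D 1 u)\<^sup>2)"
  by (simp add: log_ratio_def power2_eq_square field_simps)

lemma tendsto_near:
  assumes "((\<lambda>h. d h) \<longlongrightarrow> 0) F" "\<And>h. \<bar>\<xi> h - u\<bar> \<le> \<bar>d h\<bar>"
  shows "((\<lambda>h. D k (\<xi> h)) \<longlongrightarrow> D k u) F"
proof -
  have "((\<lambda>h. \<xi> h - u) \<longlongrightarrow> 0) F"
    by (rule Lim_null_comparison[OF _ tendsto_rabs_zero[OF assms(1)]]) (use assms(2) in auto)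
  then have "(\<xi> \<longlongrightarrow> u) F" by (simp add: LIM_zero_iff)
  then show ?thesis by (rule isCont_tendsto_compose[OF isCont_iterate])
qed

text \<open>Without drift the two squares coincide, so the log ratio is \<open>g u - g v\<close> and
  the mean value theorem suffices.\<close>

lemma scaled_log_ratio_RWM:
  "tame (scaled_log_ratio RWM)"
  "((\<lambda>h. scaled_log_ratio RWM h u z) \<longlongrightarrow> leading_term RWM u z) (at_right 0)"
proof -
  obtain \<xi> where \<xi>: "\<And>u d. \<bar>\<xi> u d - u\<bar> \<le> \<bar>d\<bar>" "\<And>u d. D 0 (u + d) = D 0 u + D 1 (\<xi> u d) * d"
    using taylor[of 0 1] by auto
  have eq: "scaled_log_ratio RWM h u z = - z * D 1 (\<xi> u (h * z))" if "h > 0" for h u z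
    using that \<xi>(2)[of u "h * z"] by (simp add: scaled_log_ratio_def log_ratio_def)
  have "tame (\<lambda>h u z. \<xi> u (h * z))"
    by (rule tame_near[OF tame_u tame_mult[OF tame_h tame_z]]) (rule \<xi>)
  then have "tame (\<lambda>h u z. - z * D 1 (\<xi> u (h * z)))"
    by (intro tame_intros tame_poly_bounded[OF poly_bounded])
  then show "tame (scaled_log_ratio RWM)"
    by (rule tame_mono) (simp add: eq)
  have "((\<lambda>h. - z * D 1 (\<xi> u (h * z))) \<longlongrightarrow> leading_term RWM u z) (at_right 0)"
    unfolding leading_term.simps
    by (intro tendsto_intros tendsto_near[where d = "\<lambda>h. h * z"] \<xi>) (auto intro!: tendsto_eq_intros)
  then show "((\<lambda>h. scaled_log_ratio RWM h u z) \<longlongrightarrow> leading_term RWM u z) (at_right 0)"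
    by (rule Lim_transform_eventually) (simp add: eq eventually_at_filter)
qed

text \<open>The trapezoidal error is cubic in the displacement, and the gradient term is h^2 times a
  displacement. The displacement has order h, so both have order h^3.\<close>

lemma scaled_log_ratio_SLA:
  "tame (scaled_log_ratio SLA)"
  "((\<lambda>h. scaled_log_ratio SLA h u z) \<longlongrightarrow> leading_term SLA u z) (at_right 0)"
proof -
  \<comment> \<open>\<open>\<xi>\<close> expands g and \<open>\<eta>\<close> expands g' for the
    trapezoidal error; \<open>\<zeta>\<close> serves the difference of squared gradients.\<close>
  obtain \<xi> where \<xi>: "\<And>u d. \<bar>\<xi> u d - u\<bar> \<le> \<bar>d\<bar>"
      "\<And>u d. D 0 (u + d) = D 0 u + D 1 u * d + D 2 u / 2 * d\<^sup>2 + D 3 (\<xi> u d) / 6 * d ^ 3"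
    using taylor[of 0 3] by (auto simp: numeral_eq_Suc)
  obtain \<eta> where \<eta>: "\<And>u d. \<bar>\<eta> u d - u\<bar> \<le> \<bar>d\<bar>"
      "\<And>u d. D 1 (u + d) = D 1 u + D 2 u * d + D 3 (\<eta> u d) / 2 * d\<^sup>2"
    using taylor[of 1 2] by (auto simp: numeral_eq_Suc)
  obtain \<zeta> where \<zeta>: "\<And>u d. \<bar>\<zeta> u d - u\<bar> \<le> \<bar>d\<bar>" "\<And>u d. D 1 (u + d) = D 1 u + D 2 (\<zeta> u d) * d"
    using taylor[of 1 1] by (auto simp: numeral_eq_Suc)
  \<comment> \<open>\<open>d\<close> is the displacement from \<open>u\<close> to the proposal, and
    \<open>e\<close> is \<open>d / h\<close>, which tends to \<open>z\<close>.\<close>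
  define e where "e h u z = z - h / 2 * D 1 u" for h u z
  define d where "d h u z = h * e h u z" for h u z
  define R where "R h u z = e h u z ^ 3 * (D 3 (\<eta> u (d h u z)) / 4 - D 3 (\<xi> u (d h u z)) / 6) -
    e h u z * D 2 (\<zeta> u (d h u z)) * (D 1 u + D 1 (u + d h u z)) / 8" for h u z
  have eq: "scaled_log_ratio SLA h u z = R h u z" if h: "h > 0" for h u z
  proof -
    let ?d = "d h u z"
    have v: "drift_mean SLA g h u + h * z = u + ?d"
      by (simp add: d_def e_def algebra_simps power2_eq_square)
    \<comment> \<open>The terms of order one and two in \<open>d\<close> cancel. The 1/4 comes from
      half the remainder of g', the 1/6 from the remainder of g; their difference is the 1/12 in
      \<open>leading_term\<close>.\<close>
    have 1: "g u - g (u + ?d) + ?d * (D 1 u + D 1 (u + ?d)) / 2 =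
        ?d ^ 3 * (D 3 (\<eta> u ?d) / 4 - D 3 (\<xi> u ?d) / 6)"
      using \<xi>(2)[of u ?d] unfolding \<eta>(2)[of u ?d]
      by (simp add: field_simps power2_eq_square power3_eq_cube)
    have "(D 1 (u + ?d))\<^sup>2 - (D 1 u)\<^sup>2 = (D 1 (u + ?d) - D 1 u) * (D 1 u + D 1 (u + ?d))"
      by (simp add: power2_eq_square algebra_simps)
    also have "D 1 (u + ?d) - D 1 u = D 2 (\<zeta> u ?d) * ?d"
      using \<zeta>(2)[of u ?d] by simp
    finally have "log_ratio SLA g h u (u + ?d) =
        ?d ^ 3 * (D 3 (\<eta> u ?d) / 4 - D 3 (\<xi> u ?d) / 6) -
        h\<^sup>2 / 8 * (D 2 (\<zeta> u ?d) * ?d * (D 1 u + D 1 (u + ?d)))"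
      using h 1 by (subst log_ratio_SLA) simp_all
    also have "\<dots> = h ^ 3 * R h u z"
      unfolding R_def d_def[of h u z]
      by (simp add: power_mult_distrib right_diff_distrib power2_eq_square power3_eq_cube mult_ac)
    finally show ?thesis
      using h by (simp only: scaled_log_ratio_def v) simp
  qed
  have tame_D: "tame F \<Longrightarrow> tame (\<lambda>h u z. D k (F h u z))" for F k
    by (rule tame_poly_bounded[OF poly_bounded])
  have te: "tame e"
    unfolding e_def[abs_def] by (intro tame_intros tame_D)
  then have td: "tame d"
    unfolding d_def[abs_def] by (intro tame_intros)
  have "tame (\<lambda>h u z. \<xi> u (d h u z))" "tame (\<lambda>h u z. \<eta> u (d h u z))" "tame (\<lambda>h u z. \<zeta> u (d h u z))"
    by (rule tame_near[OF tame_u td], rule \<xi> \<eta> \<zeta>)+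
  then have "tame R"
    unfolding R_def[abs_def] by (intro tame_intros tame_D te td)
  then show "tame (scaled_log_ratio SLA)"
    by (rule tame_mono) (simp add: eq)
  have le: "((\<lambda>h. e h u z) \<longlongrightarrow> z) (at_right 0)"
    unfolding e_def by (auto intro!: tendsto_eq_intros)
  have ld: "((\<lambda>h. d h u z) \<longlongrightarrow> 0) (at_right 0)"
    unfolding d_def by (auto intro!: tendsto_eq_intros le)
  have "((\<lambda>h. R h u z) \<longlongrightarrow> z ^ 3 * (D 3 u / 4 - D 3 u / 6) - z * D 2 u * (D 1 u + D 1 u) / 8) (at_right 0)"
    unfolding R_def
    by (intro tendsto_intros le tendsto_near[OF ld] \<xi> \<eta> \<zeta>) simp_all
  also have "z ^ 3 * (D 3 u / 4 - D 3 u / 6) - z * D 2 u * (D 1 u + D 1 u) / 8 = leading_term SLA u z"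
    by (simp add: field_simps)
  finally show "((\<lambda>h. scaled_log_ratio SLA h u z) \<longlongrightarrow> leading_term SLA u z) (at_right 0)"
    by (rule Lim_transform_eventually) (simp add: eq eventually_at_filter)
qed

lemma tame_scaled_log_ratio: "tame (scaled_log_ratio A)"
  by (cases A) (auto intro: scaled_log_ratio_RWM scaled_log_ratio_SLA)

lemma tendsto_scaled_log_ratio:
  "((\<lambda>h. scaled_log_ratio A h u z) \<longlongrightarrow> leading_term A u z) (at_right 0)"
  by (cases A) (auto intro: scaled_log_ratio_RWM(2) scaled_log_ratio_SLA(2) simp del: leading_term.simps)

lemma log_ratio_scaled:
  "h > 0 \<Longrightarrow> log_ratio A g h u (drift_mean A g h u + h * z) =
    h ^ scaling_order A * scaled_log_ratio A h u z"
  by (simp add: scaled_log_ratio_def)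

text \<open>By tameness T^2 is at most \<open>h ^ (2 * scaling_order A)\<close> times a product of a
  power of 1 + |u| and a power of 1 + |z|, both of finite mean.\<close>

lemma affinity_lower:
  "\<exists>C. C \<ge> 0 \<and> (\<forall>h. 0 < h \<longrightarrow> h \<le> 1 \<longrightarrow> 1 - C * h ^ (2 * scaling_order A) \<le> affinity A g h)"
proof -
  obtain K N where K: "K \<ge> 0"
    "\<And>h u z. 0 < h \<Longrightarrow> h \<le> 1 \<Longrightarrow> \<bar>scaled_log_ratio A h u z\<bar> \<le> K * ((1 + \<bar>u\<bar>) * (1 + \<bar>z\<bar>)) ^ N"
    using tame_scaled_log_ratio unfolding tame_def by blast
  define I where "I = (\<integral>\<^sup>+x. ennreal (exp (- g x) * (1 + \<bar>x\<bar>) ^ (2 * N)) \<partial>lborel)"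
  define J where "J = (\<integral>\<^sup>+x. ennreal (std_normal_density x * (1 + \<bar>x\<bar>) ^ (2 * N)) \<partial>lborel)"
  have "I < \<infinity>"
    unfolding I_def by (rule nn_integral_moment_finite[OF moments]) simp
  moreover have "J < \<infinity>"
    unfolding J_def
    by (rule nn_integral_moment_finite)
      (use integrable_std_normal_moment in \<open>auto simp: mult.commute\<close>)
  ultimately obtain a b where ab: "I = ennreal a" "J = ennreal b" "a \<ge> 0" "b \<ge> 0"
    by (cases I; cases J) auto
  have "1 - affinity A g h \<le> (K\<^sup>2 * a * b) * h ^ (2 * scaling_order A)" if h: "0 < h" "h \<le> 1" for h
  proof -
    let ?c = "h ^ (2 * scaling_order A) * K\<^sup>2"
    have "ennreal (1 - affinity A g h) \<le>
        step_integral A g h (\<lambda>u v. ennreal ((log_ratio A g h u v)\<^sup>2))"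
      using h(1) by (rule one_minus_affinity_le)
    also have "\<dots> \<le> (\<integral>\<^sup>+u. \<integral>\<^sup>+z. ennreal ?c * ennreal ((1 + \<bar>u\<bar>) ^ (2 * N)) * ennreal ((1 + \<bar>z\<bar>) ^ (2 * N))
        \<partial>density lborel std_normal_density \<partial>density lborel (\<lambda>u. exp (- g u)))"
      unfolding step_integral_def
    proof (intro nn_integral_mono)
      fix u z
      have "(scaled_log_ratio A h u z)\<^sup>2 \<le> (K * ((1 + \<bar>u\<bar>) * (1 + \<bar>z\<bar>)) ^ N)\<^sup>2"
        using K(2)[OF h, of u z] K(1) by (intro abs_le_square_iff[THEN iffD1]) auto
      then have "(log_ratio A g h u (drift_mean A g h u + h * z))\<^sup>2 \<le>
          ?c * (1 + \<bar>u\<bar>) ^ (2 * N) * (1 + \<bar>z\<bar>) ^ (2 * N)"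
        using h(1) by (simp add: log_ratio_scaled power_mult_distrib power_mult[symmetric]
            mult.commute[of _ "2::nat"] mult.assoc mult_left_mono)
      then show "ennreal ((log_ratio A g h u (drift_mean A g h u + h * z))\<^sup>2) \<le>
          ennreal ?c * ennreal ((1 + \<bar>u\<bar>) ^ (2 * N)) * ennreal ((1 + \<bar>z\<bar>) ^ (2 * N))"
        by (simp add: ennreal_mult''[symmetric] ennreal_leI)
    qed
    also have "\<dots> = ennreal ?c * I * J"
      by (simp add: nn_integral_cmult nn_integral_multc nn_integral_density I_def J_def ennreal_mult mult.assoc
          mult.left_commute)
    also have "\<dots> = ennreal ((K\<^sup>2 * a * b) * h ^ (2 * scaling_order A))"
      using ab h by (simp add: ennreal_mult[symmetric] mult_ac)
    finally show ?thesis
      using ab K h by (subst (asm) ennreal_le_iff) auto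
  qed
  then show ?thesis
    using ab K by (intro exI[of _ "K\<^sup>2 * a * b"]) (auto simp: algebra_simps)
qed

end

section \<open>Sharpness of the order\<close>

text \<open>The minorant to which Fatou's lemma is applied: it keeps the exact leading term t^2 / 4,
  damped by a factor that tends to 1 as \<open>t\<close> tends to 0. For \<open>t < 0\<close> the
  damping comes from factoring out \<open>exp (t / 2)\<close>.\<close>

lemma one_minus_exp_half_sq_ge: "t\<^sup>2 / 4 * exp (- \<bar>t\<bar>) \<le> (1 - exp (t / 2))\<^sup>2" for t :: real
proof (cases "t \<ge> 0")
  case True
  have "t / 2 \<le> exp (t / 2) - 1"
    using exp_ge_add_one_self[of "t / 2"] by linarith
  then have "(t / 2)\<^sup>2 \<le> (exp (t / 2) - 1)\<^sup>2"
    using True by (intro power_mono) auto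
  moreover have "t\<^sup>2 / 4 * exp (- \<bar>t\<bar>) \<le> t\<^sup>2 / 4 * 1"
    by (intro mult_left_mono) auto
  ultimately show ?thesis
    by (simp add: power_divide power2_commute)
next
  case False
  have "- t / 2 * exp (t / 2) \<le> 1 - exp (t / 2)"
  proof -
    have "exp (t / 2) * (1 - t / 2) \<le> exp (t / 2) * exp (- t / 2)"
      using exp_ge_add_one_self[of "- t / 2"] by (intro mult_left_mono) auto
    then show ?thesis by (simp add: mult_exp_exp algebra_simps)
  qed
  then have "(- t / 2 * exp (t / 2))\<^sup>2 \<le> (1 - exp (t / 2))\<^sup>2"
    using False by (intro power_mono) (auto simp: mult_nonpos_nonneg)
  moreover have "(exp (t / 2))\<^sup>2 = exp t"
    by (simp add: exp_double[symmetric])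
  ultimately show ?thesis
    using False by (simp add: power_mult_distrib power_divide)
qed

context smooth_density
begin

text \<open>A vanishing leading term makes g affine, g u = c + b u. Translation by 1 multiplies
  exp(-g) by exp(-b) but preserves its mass 1, so b = 0; a constant density then has infinite
  mass.\<close>

lemma leading_term_nonzero: "\<exists>u z. leading_term A u z \<noteq> 0"
proof (rule ccontr)
  assume "\<not> (\<exists>u z. leading_term A u z \<noteq> 0)"
  then have 0: "\<And>u z. leading_term A u z = 0" by blast
  have "\<exists>b. \<forall>u. D 1 u = b"
  proof (cases A)
    case RWM
    have "D 1 u = 0" for u
      using 0[of u 1] RWM by simp
    then show ?thesis by blast
  next
    case SLA
    \<comment> \<open>Two values of \<open>z\<close> separate the cubic from the linear
      coefficient.\<close>
    have D: "D 3 u = 0" "D 1 u * D 2 u = 0" for u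
      using 0[of u 1] 0[of u 2] SLA by (simp_all add: field_simps)
    have "\<exists>a. \<forall>u. D 2 u = a"
    proof -
      have "(D 2 has_real_derivative 0) (at u)" for u
        using DERIV_iterate[of 2 u UNIV] D(1)[of u] by (simp add: numeral_eq_Suc)
      then show ?thesis
        using DERIV_isconst_all[of "D 2"] by metis
    qed
    then obtain a where a: "\<And>u. D 2 u = a" by blast
    have D1: "(D 1 has_real_derivative a) (at u)" for u
      using DERIV_iterate[of 1 u UNIV] a[of u] by (simp add: numeral_eq_Suc)
    \<comment> \<open>If the constant second derivative were nonzero, g' g'' = 0 would force g' to
      vanish identically, and with it g''.\<close>
    have "a = 0"
    proof (rule ccontr)
      assume "a \<noteq> 0"
      then have "D 1 = (\<lambda>_. 0)"
        using D(2) a by (metis mult_eq_0_iff)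
      with D1[of 0] have "((\<lambda>_. 0) has_real_derivative a) (at (0::real))" by simp
      with \<open>a \<noteq> 0\<close> show False
        using DERIV_unique[OF _ DERIV_const] by blast
    qed
    then show ?thesis
      using D1 DERIV_isconst_all[of "D 1"] by metis
  qed
  then obtain b where b: "\<And>u. D 1 u = b" by blast
  have "((\<lambda>u. g u - b * u) has_real_derivative 0) (at u)" for u
    using DERIV_iterate[of 0 u UNIV] b[of u] by (auto intro!: derivative_eq_intros)
  then obtain c where "\<And>u. g u - b * u = c"
    using DERIV_isconst_all[of "\<lambda>u. g u - b * u"] by metis
  then have g: "g u = c + b * u" for u by (metis diff_add_cancel)
  interpret prob_space "density lborel (\<lambda>x. ennreal (exp (- g x)))" by (rule prob)
  have one: "(\<integral>\<^sup>+u. ennreal (exp (- g u)) \<partial>lborel) = 1"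
    using emeasure_space_1 by (simp add: emeasure_density)
  have "1 = (\<integral>\<^sup>+u. ennreal (exp (- g (1 + 1 * u))) \<partial>lborel)"
    using nn_integral_real_affine[of "\<lambda>u. ennreal (exp (- g u))" 1 1] one by simp
  also have "\<dots> = (\<integral>\<^sup>+u. ennreal (exp (- b)) * ennreal (exp (- g u)) \<partial>lborel)"
    by (intro nn_integral_cong, subst ennreal_mult[symmetric])
      (auto simp: g mult_exp_exp algebra_simps)
  also have "\<dots> = ennreal (exp (- b))"
    by (simp add: nn_integral_cmult one)
  finally have "b = 0"
    by (simp add: ennreal_1[symmetric] del: ennreal_1)
  then have "(\<integral>\<^sup>+u. ennreal (exp (- g u)) \<partial>lborel) = \<infinity>"
    by (simp add: g ennreal_mult_top)
  with one show False by simp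
qed

section \<open>Null sets of the joint law of state and noise\<close>

lemma continuous_leading_term: "continuous_on UNIV (\<lambda>(u, z). leading_term A u z)"
proof -
  have D: "continuous_on UNIV (\<lambda>x. D k (fst x))" for k
    by (rule continuous_on_compose2[of UNIV "D k"])
      (auto intro!: continuous_intros continuous_at_imp_continuous_on isCont_iterate)
  show ?thesis
    by (cases A) (auto simp: case_prod_beta' intro!: continuous_intros D simp del: funpow.simps)
qed

text \<open>Joint law of state and noise on the plane. Its density is strictly positive, so its null
  sets are those of Lebesgue measure.\<close>

definition step_measure :: "(real \<times> real) measure" where
  "step_measure = density lborel (\<lambda>u. ennreal (exp (- g u))) \<Otimes>\<^sub>M density lborel std_normal_density"

lemma step_measure_eq:
  "step_measure = density lborel (\<lambda>(u, z). ennreal (exp (- g u)) * ennreal (std_normal_density z))"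
  unfolding step_measure_def lborel_prod[symmetric]
  by (intro pair_measure_density sigma_finite_normal lborel.sigma_finite_measure_axioms) simp_all

lemma sets_step_measure [measurable_cong, simp]: "sets step_measure = sets (borel \<Otimes>\<^sub>M borel)"
  by (simp only: step_measure_eq sets_density sets_lborel borel_prod)

lemma step_integral_step_measure:
  assumes [measurable]: "case_prod F \<in> borel_measurable (borel \<Otimes>\<^sub>M borel)"
  shows "step_integral A g h F =
    (\<integral>\<^sup>+(u, z). F u (drift_mean A g h u + h * z) \<partial>step_measure)"
proof -
  interpret sigma_finite_measure "density lborel std_normal_density" by (rule sigma_finite_normal)
  show ?thesis
    unfolding step_integral_def step_measure_def by (subst nn_integral_fst[symmetric]) simp_all
qed

text \<open>A zero integral makes the leading term vanish almost everywhere. Its zero set is closed,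
  and a closed set of full Lebesgue measure is the whole plane, against
  \<open>leading_term_nonzero\<close>.\<close>

lemma leading_term_not_null:
  "(\<integral>\<^sup>+(u, z). ennreal ((leading_term A u z)\<^sup>2 / 4) \<partial>step_measure) \<noteq> 0"
proof
  have [measurable]: "(\<lambda>(u, z). leading_term A u z) \<in> borel_measurable borel"
    by (intro borel_measurable_continuous_onI continuous_leading_term)
  have [measurable]: "(\<lambda>p. case p of (u, z) \<Rightarrow> ennreal ((leading_term A u z)\<^sup>2 / 4)) \<in> borel_measurable borel"
    using continuous_leading_term[of A] unfolding case_prod_beta'
    by (intro measurable_compose[OF _ measurable_ennreal] borel_measurable_continuous_onI continuous_intros)
      (auto simp: case_prod_beta')
  assume "(\<integral>\<^sup>+(u, z). ennreal ((leading_term A u z)\<^sup>2 / 4) \<partial>step_measure) = 0"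
  then have "AE p in step_measure. (case p of (u, z) \<Rightarrow> ennreal ((leading_term A u z)\<^sup>2 / 4)) = 0"
    by (subst (asm) nn_integral_0_iff_AE) (simp_all add: step_measure_eq)
  then have "AE p in step_measure. (case p of (u, z) \<Rightarrow> leading_term A u z) = 0"
    by (auto simp: ennreal_eq_0_iff split_beta')
  then have "AE p in lborel. (case p of (u, z) \<Rightarrow> leading_term A u z) = 0"
    unfolding step_measure_eq
    by (subst (asm) AE_density)
      (auto simp: split_beta' ennreal_mult_eq_top_iff ennreal_zero_less_mult_iff normal_density_pos
        borel_prod[symmetric])
  then have "AE p in lebesgue. p \<in> {p. (case p of (u, z) \<Rightarrow> leading_term A u z) = 0}"
    by (simp add: AE_completion)
  moreover have "closed {p. (case p of (u, z) \<Rightarrow> leading_term A u z) = 0}"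
    by (intro closed_Collect_eq continuous_leading_term continuous_intros)
  ultimately have "p \<in> {p. (case p of (u, z) \<Rightarrow> leading_term A u z) = 0}" for p
    by (intro mem_closed_if_AE_lebesgue)
  then show False
    using leading_term_nonzero[of A] by auto
qed

text \<open>Otherwise the Hellinger integral divided by \<open>h ^ (2 * scaling_order A)\<close>
  tends to 0 along some steps tending to 0, whereas Fatou's lemma bounds its lower limit below by a
  quarter of the mean squared leading term, which is positive.\<close>

lemma affinity_upper:
  "\<exists>c h0. c > 0 \<and> h0 > 0 \<and> (\<forall>h. 0 < h \<longrightarrow> h \<le> h0 \<longrightarrow>
     affinity A g h \<le> 1 - c * h ^ (2 * scaling_order A))"
proof (rule ccontr)
  assume neg: "\<not> ?thesis"
  let ?m = "scaling_order A"
  \<comment> \<open>The negation is used with both constants equal to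
    \<open>1 / real (Suc n)\<close>.\<close>
  have "\<exists>h>0. h \<le> 1 / real (Suc n) \<and> 1 - 1 / real (Suc n) * h ^ (2 * ?m) < affinity A g h" for n
  proof (rule ccontr)
    assume "\<not> ?thesis"
    then have "\<forall>h. 0 < h \<longrightarrow> h \<le> 1 / real (Suc n) \<longrightarrow>
        affinity A g h \<le> 1 - 1 / real (Suc n) * h ^ (2 * ?m)"
      by (meson not_le)
    moreover have "0 < 1 / real (Suc n)" by simp
    ultimately show False using neg by blast
  qed
  then obtain h where h: "\<And>n. h n > 0" "\<And>n. h n \<le> 1 / real (Suc n)"
      "\<And>n. 1 - 1 / real (Suc n) * h n ^ (2 * ?m) < affinity A g (h n)"
    by metis
  have h0: "h \<longlonglongrightarrow> 0"
    by (rule tendsto_sandwich[OF _ _ tendsto_const LIMSEQ_inverse_real_of_nat])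
      (use h in \<open>auto simp: inverse_eq_divide intro!: less_imp_le always_eventually\<close>)
  have lim: "(\<lambda>n. scaled_log_ratio A (h n) u z) \<longlonglongrightarrow> leading_term A u z" for u z
    by (rule filterlim_compose[OF tendsto_scaled_log_ratio])
      (use h(1) h0 in \<open>auto simp: filterlim_at less_imp_neq[OF h(1), symmetric] intro!: always_eventually\<close>)
  \<comment> \<open>The minorant of the Hellinger integrand divided by
    \<open>h n ^ (2 * ?m)\<close>. The exponential contains the unscaled log ratio, which tends to
    0, so the damping disappears in the limit.\<close>
  define \<Phi> where "\<Phi> n p = ennreal ((scaled_log_ratio A (h n) (fst p) (snd p))\<^sup>2 / 4 *
      exp (- \<bar>h n ^ ?m * scaled_log_ratio A (h n) (fst p) (snd p)\<bar>))" for n p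
  have [measurable]: "(\<lambda>(u, z). scaled_log_ratio A t u z) \<in> borel_measurable (borel \<Otimes>\<^sub>M borel)" for t
    unfolding scaled_log_ratio_def by measurable
  have [measurable]: "\<Phi> n \<in> borel_measurable (borel \<Otimes>\<^sub>M borel)" for n
    unfolding \<Phi>_def by measurable
  have lim_\<Phi>: "(\<lambda>n. \<Phi> n p) \<longlonglongrightarrow> ennreal ((leading_term A (fst p) (snd p))\<^sup>2 / 4)" for p
  proof -
    have m: "?m > 0" by (cases A) auto
    have "(\<lambda>n. (scaled_log_ratio A (h n) (fst p) (snd p))\<^sup>2 / 4 *
        exp (- \<bar>h n ^ ?m * scaled_log_ratio A (h n) (fst p) (snd p)\<bar>)) \<longlonglongrightarrow>
        (leading_term A (fst p) (snd p))\<^sup>2 / 4 * exp (- \<bar>0 ^ ?m * leading_term A (fst p) (snd p)\<bar>)"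
      by (intro tendsto_intros lim h0) simp
    then show ?thesis
      unfolding \<Phi>_def by (intro tendsto_ennrealI) (simp add: zero_power[OF m])
  qed
  have int_\<Phi>: "integral\<^sup>N step_measure (\<Phi> n) \<le> ennreal (2 / real (Suc n))" for n
  proof -
    have pos: "h n ^ (2 * ?m) > 0" using h(1) by simp
    have "ennreal (h n ^ (2 * ?m)) * integral\<^sup>N step_measure (\<Phi> n) =
        (\<integral>\<^sup>+p. ennreal (h n ^ (2 * ?m)) * \<Phi> n p \<partial>step_measure)"
      by (subst nn_integral_cmult) simp_all
    also have "\<dots> \<le> step_integral A g (h n)
        (\<lambda>u v. ennreal ((1 - exp (log_ratio A g (h n) u v / 2))\<^sup>2))"
    proof (subst step_integral_step_measure, measurable, intro nn_integral_mono)
      fix p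
      have "ennreal (h n ^ (2 * ?m)) * \<Phi> n p =
          ennreal ((h n ^ ?m * scaled_log_ratio A (h n) (fst p) (snd p))\<^sup>2 / 4 *
          exp (- \<bar>h n ^ ?m * scaled_log_ratio A (h n) (fst p) (snd p)\<bar>))"
        unfolding \<Phi>_def using pos
        by (subst ennreal_mult[symmetric])
          (auto simp: power_mult_distrib power_mult[symmetric] mult.commute[of _ "2::nat"] mult.assoc)
      also have "\<dots> \<le> ennreal ((1 - exp (h n ^ ?m * scaled_log_ratio A (h n) (fst p) (snd p) / 2))\<^sup>2)"
        by (intro ennreal_leI one_minus_exp_half_sq_ge)
      also have "\<dots> = (case p of (u, z) \<Rightarrow>
          ennreal ((1 - exp (log_ratio A g (h n) u (drift_mean A g (h n) u + h n * z) / 2))\<^sup>2))"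
        using h(1) by (simp add: log_ratio_scaled split_beta')
      finally show "ennreal (h n ^ (2 * ?m)) * \<Phi> n p \<le> \<dots>" .
    qed
    also have "\<dots> = ennreal (2 - 2 * affinity A g (h n))"
      using h(1) by (rule hellinger_affinity)
    also have "\<dots> \<le> ennreal (h n ^ (2 * ?m) * (2 / real (Suc n)))"
      using h(3)[of n] by (intro ennreal_leI) (simp add: field_simps)
    also have "\<dots> = ennreal (h n ^ (2 * ?m)) * ennreal (2 / real (Suc n))"
      using pos by (subst ennreal_mult) auto
    finally show ?thesis
      using less_imp_neq[OF pos, symmetric] by (subst (asm) ennreal_mult_le_mult_iff) auto
  qed
  have "(\<integral>\<^sup>+(u, z). ennreal ((leading_term A u z)\<^sup>2 / 4) \<partial>step_measure) =
      (\<integral>\<^sup>+p. liminf (\<lambda>n. \<Phi> n p) \<partial>step_measure)"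
    using lim_imp_Liminf[OF sequentially_bot lim_\<Phi>] by (simp add: split_beta')
  also have "\<dots> \<le> liminf (\<lambda>n. integral\<^sup>N step_measure (\<Phi> n))"
    by (intro nn_integral_liminf) simp
  also have "\<dots> \<le> liminf (\<lambda>n. ennreal (2 / real (Suc n)))"
    by (intro Liminf_mono always_eventually allI int_\<Phi>)
  also have "\<dots> = 0"
  proof (rule lim_imp_Liminf)
    have "(\<lambda>n. 2 / real (Suc n)) \<longlonglongrightarrow> 0" by real_asymp
    then show "(\<lambda>n. ennreal (2 / real (Suc n))) \<longlonglongrightarrow> 0"
      using tendsto_ennrealI by fastforce
  qed simp
  finally show False
    using leading_term_not_null[of A] by simp
qed

end

section \<open>Product structure\<close>

lemma normal_density_scale:
  assumes "c > 0"
  shows "normal_density (c * m) s (c * v) = normal_density m (s / c) v / c"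
proof -
  have "(c * v - c * m)\<^sup>2 / (2 * s\<^sup>2) = (v - m)\<^sup>2 / (2 * (s / c)\<^sup>2)"
    using assms by (simp add: right_diff_distrib[symmetric] power_mult_distrib power_divide mult.commute)
  moreover have "sqrt (2 * pi * s\<^sup>2) = c * sqrt (2 * pi * (s / c)\<^sup>2)"
    using assms by (simp add: power_divide real_sqrt_mult real_sqrt_divide)
  ultimately show ?thesis
    by (simp add: normal_density_def)
qed

text \<open>One fixed dimension, so that the dependence of the final bounds on \<open>n\<close> is
  confined to a product of affinities.\<close>

locale mh_step = smooth_density g for g :: "real \<Rightarrow> real" +
  fixes A :: algorithm and \<kappa> s M :: real and n :: nat and \<phi> :: "(nat \<Rightarrow> real) \<Rightarrow> real"
  assumes s: "s > 0"
    and measurable_potential: "\<phi> \<in> borel_measurable (PiM {1..n} (\<lambda>_. borel))"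
    and potential_bounded: "x \<in> space (lebesgue_n n) \<Longrightarrow> \<bar>\<phi> x\<bar> \<le> M"
begin

abbreviation f :: "real \<Rightarrow> real" where "f \<equiv> \<lambda>x. exp (- g x)"

abbreviation lam :: "nat \<Rightarrow> real" where "lam \<equiv> coord_scale \<kappa>"

definition step :: "nat \<Rightarrow> real" where "step i = s / lam i"

section \<open>Reduction to rescaled coordinates\<close>

lemma lam_pos: "i \<in> {1..n} \<Longrightarrow> lam i > 0"
  by (rule coord_scale_pos) simp

lemma step_pos: "i \<in> {1..n} \<Longrightarrow> step i > 0"
  by (simp add: step_def s lam_pos)

text \<open>With h = s / lambda, the SLA coefficient s^2 / (2 lambda) equals lambda h^2 / 2, so in
  units of lambda the drift is the one-dimensional one.\<close>

lemma proposal_mean_eq: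
  "i \<in> {1..n} \<Longrightarrow> proposal_mean A f \<kappa> n s x i = lam i * drift_mean A g (step i) (x i / lam i)"
  using lam_pos[of i]
  by (cases A)
    (auto simp: proposal_mean_SLA[OF smooth refl] step_def field_simps power2_eq_square
      simp del: proposal_mean.simps(2))

definition log_ratio_n :: "(nat \<Rightarrow> real) \<Rightarrow> (nat \<Rightarrow> real) \<Rightarrow> real" where
  "log_ratio_n x y = (\<Sum>i\<in>{1..n}. log_ratio A g (step i) (x i / lam i) (y i / lam i))"

text \<open>The joint density of state and proposal is \<open>exp (- \<phi> x)\<close> times a
  product over the coordinates, and detailed balance applies to each factor.\<close>

lemma acceptance_prob_eq:
  "acceptance_prob A f \<kappa> n s \<phi> x y = min 1 (exp (\<phi> x - \<phi> y) * exp (log_ratio_n x y))"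
proof -
  let ?p = "target_density f \<kappa> n \<phi>" and ?q = "proposal_density A f \<kappa> n s"
  define w where "w x y i = inverse (lam i) * f (x i / lam i) *
    normal_density (proposal_mean A f \<kappa> n s x i) s (y i)" for x y i
  have pq: "?p x * ?q x y = exp (- \<phi> x) * (\<Prod>i\<in>{1..n}. w x y i)" for x y
    by (simp add: target_density_def ref_density_def proposal_density_def w_def prod.distrib)
  have w: "w y x i = exp (log_ratio A g (step i) (x i / lam i) (y i / lam i)) * w x y i"
    if i: "i \<in> {1..n}" for i
  proof -
    have nd: "normal_density (proposal_mean A f \<kappa> n s x i) s (y i) =
        normal_density (drift_mean A g (step i) (x i / lam i)) (step i) (y i / lam i) / lam i" for x y
      using normal_density_scale[OF lam_pos[OF i], of "drift_mean A g (step i) (x i / lam i)" s "y i / lam i"]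
        lam_pos[OF i] by (simp add: proposal_mean_eq[OF i] step_def)
    show ?thesis
      using detailed_balance[OF step_pos[OF i], of A "x i / lam i" "y i / lam i"]
      unfolding w_def nd by (simp add: field_simps)
  qed
  \<comment> \<open>Positivity excludes the default value 0 in \<open>mh_acceptance\<close>.\<close>
  have pos: "?p x * ?q x y > 0"
    unfolding pq w_def using s
    by (intro mult_pos_pos prod_pos normal_density_pos) (auto simp: lam_pos)
  have "?p y * ?q y x = exp (\<phi> x - \<phi> y) * exp (log_ratio_n x y) * (?p x * ?q x y)"
    unfolding pq by (simp add: w prod.distrib log_ratio_n_def exp_sum exp_diff exp_minus field_simps)
  then have "?p y * ?q y x / (?p x * ?q x y) = exp (\<phi> x - \<phi> y) * exp (log_ratio_n x y)"
    using less_imp_neq[OF pos] by (simp only: nonzero_mult_div_cancel_right)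
  with pos show ?thesis
    by (simp only: acceptance_prob_def mh_acceptance_def if_True)
qed

lemma proposal_eq:
  assumes "i \<in> {1..n}"
  shows "proposal A f \<kappa> n s x z i / lam i =
    drift_mean A g (step i) (x i / lam i) + step i * z i"
  using assms lam_pos[OF assms] by (simp add: proposal_def proposal_mean_eq step_def field_simps)

lemma sets_PiM_borel: "sets (PiM {1..n} (\<lambda>_. borel :: real measure)) = sets (lebesgue_n n)"
  by (intro sets_PiM_cong) simp_all

lemma measurable_potential' [measurable]: "\<phi> \<in> borel_measurable (lebesgue_n n)"
  using measurable_potential unfolding measurable_cong_sets[OF sets_PiM_borel refl] .

lemma sets_std_gaussian [measurable_cong, simp]: "sets (std_gaussian n) = sets (lebesgue_n n)"
  unfolding std_gaussian_def by (intro sets_PiM_cong) simp_all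

lemma sets_ref_measure [measurable_cong, simp]: "sets (ref_measure f \<kappa> n) = sets (lebesgue_n n)"
  by (simp add: ref_measure_def)

lemma sets_target_measure [measurable_cong, simp]:
  "sets (target_measure f \<kappa> n \<phi>) = sets (lebesgue_n n)"
  by (simp add: target_measure_def)

text \<open>The SLA mean contains a formal partial derivative; its explicit form on
  \<open>{1..n}\<close> makes measurability a matter of composition.\<close>

lemma measurable_proposal [measurable]:
  "(\<lambda>(x, z). proposal A f \<kappa> n s x z) \<in> measurable (lebesgue_n n \<Otimes>\<^sub>M lebesgue_n n) (lebesgue_n n)"
proof -
  have eq: "proposal A f \<kappa> n s = (\<lambda>x z. \<lambda>i\<in>{1..n}.
      lam i * drift_mean A g (step i) (x i / lam i) + s * z i)"
    unfolding proposal_def by (intro ext restrict_ext) (simp add: proposal_mean_eq)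
  show ?thesis unfolding eq by measurable
qed

lemma measurable_log_ratio_n [measurable]:
  "(\<lambda>(x, z). log_ratio_n x (proposal A f \<kappa> n s x z)) \<in>
    borel_measurable (lebesgue_n n \<Otimes>\<^sub>M lebesgue_n n)"
proof -
  have eq: "log_ratio_n x (proposal A f \<kappa> n s x z) =
      (\<Sum>i\<in>{1..n}. log_ratio A g (step i) (x i / lam i)
        (drift_mean A g (step i) (x i / lam i) + step i * z i))" for x z
    unfolding log_ratio_n_def by (intro sum.cong refl) (simp only: proposal_eq)
  show ?thesis unfolding eq by measurable
qed

section \<open>Integrals under the product reference law\<close>

lemma proposal_in_space: "proposal A f \<kappa> n s x z \<in> space (lebesgue_n n)"
  by (simp add: space_PiM proposal_def)

lemma prob_space_std_gaussian: "prob_space (std_gaussian n)"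
  unfolding std_gaussian_def
  by (intro prob_space_PiM prob_space_normal_density) simp

lemma measurable_ref_density [measurable]: "ref_density f \<kappa> n \<in> borel_measurable (lebesgue_n n)"
  unfolding ref_density_def[abs_def] by measurable

text \<open>Independence of the coordinates: integrating the noise first gives a product of the
  \<open>K i\<close>, and integrating the state gives a product again.\<close>

lemma nn_integral_prod_step:
  assumes F [measurable]: "\<And>i. case_prod (F i) \<in> borel_measurable (borel \<Otimes>\<^sub>M borel)"
  shows "(\<integral>\<^sup>+(x, z). (\<Prod>i\<in>{1..n}. F i (x i / lam i) (proposal A f \<kappa> n s x z i / lam i))
      \<partial>(ref_measure f \<kappa> n \<Otimes>\<^sub>M std_gaussian n)) =
    (\<Prod>i\<in>{1..n}. step_integral A g (step i) (F i))"
proof -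
  interpret G: prob_space "std_gaussian n" by (rule prob_space_std_gaussian)
  interpret N: prob_space "density lborel std_normal_density"
    by (rule prob_space_normal_density) simp
  interpret PN: product_prob_space "\<lambda>_::nat. density lborel std_normal_density" ..
  interpret L: product_sigma_finite "\<lambda>_::nat. lborel :: real measure" ..
  define K where "K i u = (\<integral>\<^sup>+z. F i u (drift_mean A g (step i) u + step i * z)
    \<partial>density lborel std_normal_density)" for i u
  have [measurable]: "K i \<in> borel_measurable borel" for i
    unfolding K_def by measurable
  have "(\<integral>\<^sup>+(x, z). (\<Prod>i\<in>{1..n}. F i (x i / lam i) (proposal A f \<kappa> n s x z i / lam i))
      \<partial>(ref_measure f \<kappa> n \<Otimes>\<^sub>M std_gaussian n)) =
      (\<integral>\<^sup>+x. \<integral>\<^sup>+z. (\<Prod>i\<in>{1..n}. F i (x i / lam i)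
        (drift_mean A g (step i) (x i / lam i) + step i * z i))
      \<partial>std_gaussian n \<partial>ref_measure f \<kappa> n)"
    by (subst G.nn_integral_fst[symmetric]) (simp_all add: proposal_eq)
  also have "\<dots> = (\<integral>\<^sup>+x. (\<Prod>i\<in>{1..n}. K i (x i / lam i)) \<partial>ref_measure f \<kappa> n)"
    unfolding std_gaussian_def K_def
    by (intro nn_integral_cong PN.product_nn_integral_prod) simp_all
  also have "\<dots> = (\<integral>\<^sup>+x. (\<Prod>i\<in>{1..n}. ennreal (inverse (lam i) * f (x i / lam i)) * K i (x i / lam i))
      \<partial>lebesgue_n n)"
  proof -
    have "ennreal (ref_density f \<kappa> n x) = (\<Prod>i\<in>{1..n}. ennreal (inverse (lam i) * f (x i / lam i)))" for x
      unfolding ref_density_def using lam_pos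
      by (intro prod_ennreal[symmetric]) (auto intro!: mult_nonneg_nonneg less_imp_le)
    then show ?thesis
      unfolding ref_measure_def by (subst nn_integral_density) (simp_all add: prod.distrib)
  qed
  also have "\<dots> = (\<Prod>i\<in>{1..n}. \<integral>\<^sup>+t. ennreal (inverse (lam i) * f (t / lam i)) * K i (t / lam i) \<partial>lborel)"
    by (rule L.product_nn_integral_prod) simp_all
  also have "\<dots> = (\<Prod>i\<in>{1..n}. step_integral A g (step i) (F i))"
  proof (intro prod.cong refl)
    fix i assume i: "i \<in> {1..n}"
    \<comment> \<open>Substitute t = lambda u; the Jacobian cancels the factor
      \<open>inverse (lam i)\<close> of the density.\<close>
    note l = lam_pos[OF i]
    have "(\<integral>\<^sup>+t. ennreal (inverse (lam i) * f (t / lam i)) * K i (t / lam i) \<partial>lborel) =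
        ennreal (lam i) * (\<integral>\<^sup>+u. ennreal (inverse (lam i) * f u) * K i u \<partial>lborel)"
      using l by (subst nn_integral_real_affine[where c = "lam i" and t = 0]) simp_all
    also have "\<dots> = (\<integral>\<^sup>+u. ennreal (lam i * (inverse (lam i) * f u)) * K i u \<partial>lborel)"
      using l by (subst nn_integral_cmult[symmetric]) (simp_all add: ennreal_mult mult.assoc)
    also have "\<dots> = (\<integral>\<^sup>+u. ennreal (f u) * K i u \<partial>lborel)"
      using l by (simp add: mult.assoc[symmetric])
    also have "\<dots> = step_integral A g (step i) (F i)"
      unfolding step_integral_def K_def[symmetric] by (subst nn_integral_density) simp_all
    finally show "(\<integral>\<^sup>+t. ennreal (inverse (lam i) * f (t / lam i)) * K i (t / lam i) \<partial>lborel) =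
        step_integral A g (step i) (F i)" .
  qed
  finally show ?thesis .
qed

text \<open>Mean acceptance for the unperturbed product law, that is, for \<phi> = 0.\<close>

definition ref_acceptance :: ennreal where
  "ref_acceptance = (\<integral>\<^sup>+(x, z). ennreal (min 1 (exp (log_ratio_n x (proposal A f \<kappa> n s x z))))
     \<partial>(ref_measure f \<kappa> n \<Otimes>\<^sub>M std_gaussian n))"

lemma nn_integral_exp_half:
  "(\<integral>\<^sup>+(x, z). ennreal (exp (log_ratio_n x (proposal A f \<kappa> n s x z) / 2))
      \<partial>(ref_measure f \<kappa> n \<Otimes>\<^sub>M std_gaussian n)) =
    ennreal (\<Prod>i\<in>{1..n}. affinity A g (step i))"
proof -
  have eq: "ennreal (exp (log_ratio_n x y / 2)) =
      (\<Prod>i\<in>{1..n}. ennreal (exp (log_ratio A g (step i) (x i / lam i) (y i / lam i) / 2)))" for x y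
    by (simp add: log_ratio_n_def sum_divide_distrib exp_sum prod_ennreal)
  have "(\<integral>\<^sup>+(x, z). ennreal (exp (log_ratio_n x (proposal A f \<kappa> n s x z) / 2))
        \<partial>(ref_measure f \<kappa> n \<Otimes>\<^sub>M std_gaussian n)) =
      (\<Prod>i\<in>{1..n}. step_integral A g (step i) (\<lambda>u v. ennreal (exp (log_ratio A g (step i) u v / 2))))"
    unfolding eq by (rule nn_integral_prod_step) measurable
  also have "\<dots> = (\<Prod>i\<in>{1..n}. ennreal (affinity A g (step i)))"
    by (intro prod.cong refl ennreal_affinity step_pos)
  also have "\<dots> = ennreal (\<Prod>i\<in>{1..n}. affinity A g (step i))"
    by (intro prod_ennreal affinity_nonneg)
  finally show ?thesis .
qed

text \<open>The forward and the reversed law both have mass 1. The sum stays in one integral because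
  it serves as a bound for the maximum of 1 and exp T.\<close>

lemma nn_integral_exp_one_plus:
  "(\<integral>\<^sup>+(x, z). 1 + ennreal (exp (log_ratio_n x (proposal A f \<kappa> n s x z)))
      \<partial>(ref_measure f \<kappa> n \<Otimes>\<^sub>M std_gaussian n)) = 2"
proof -
  have eq: "ennreal (exp (log_ratio_n x y)) =
      (\<Prod>i\<in>{1..n}. ennreal (exp (log_ratio A g (step i) (x i / lam i) (y i / lam i))))" for x y
    by (simp add: log_ratio_n_def exp_sum prod_ennreal)
  have "(\<integral>\<^sup>+(x, z). ennreal (exp (log_ratio_n x (proposal A f \<kappa> n s x z)))
        \<partial>(ref_measure f \<kappa> n \<Otimes>\<^sub>M std_gaussian n)) =
      (\<Prod>i\<in>{1..n}. step_integral A g (step i) (\<lambda>u v. ennreal (exp (log_ratio A g (step i) u v))))"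
    unfolding eq by (rule nn_integral_prod_step) measurable
  also have "\<dots> = 1"
    by (intro prod.neutral ballI step_integral_exp_log_ratio step_pos)
  finally have "(\<integral>\<^sup>+(x, z). ennreal (exp (log_ratio_n x (proposal A f \<kappa> n s x z)))
      \<partial>(ref_measure f \<kappa> n \<Otimes>\<^sub>M std_gaussian n)) = 1" .
  moreover have "(\<integral>\<^sup>+p. 1 \<partial>(ref_measure f \<kappa> n \<Otimes>\<^sub>M std_gaussian n)) = 1"
    using nn_integral_prod_step[of "\<lambda>_ _ _. 1"] by (simp add: step_integral_const split_beta')
  ultimately show ?thesis
    by (simp add: split_beta' nn_integral_add)
qed

lemma ref_acceptance_le: "ref_acceptance \<le> ennreal (\<Prod>i\<in>{1..n}. affinity A g (step i))"
proof -
  have "min 1 (exp t) \<le> exp (t / 2)" for t :: real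
    by (cases "t \<ge> 0") (auto simp: min_def)
  then show ?thesis
    unfolding ref_acceptance_def nn_integral_exp_half[symmetric]
    by (intro nn_integral_mono) (auto intro!: ennreal_leI)
qed

text \<open>AM-GM gives \<open>2 exp (t / 2) \<le> a max 1 (exp t) + min 1 (exp t) / a\<close>; take \<open>a\<close> to be half
  the product of the affinities.\<close>

lemma ref_acceptance_ge: "ennreal ((\<Prod>i\<in>{1..n}. affinity A g (step i))\<^sup>2 / 2) \<le> ref_acceptance"
proof (cases "(\<Prod>i\<in>{1..n}. affinity A g (step i)) = 0")
  case True
  show ?thesis unfolding True by simp
next
  case False
  define P where "P = (\<Prod>i\<in>{1..n}. affinity A g (step i))"
  define a where "a = P / 2"
  have P: "P > 0"
    using False by (simp add: P_def prod_nonneg affinity_nonneg order_less_le)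
  then have a: "a > 0" by (simp add: a_def)
  \<comment> \<open>The AM-GM inequality multiplied by \<open>a\<close>, with the maximum of 1 and
    \<open>exp t\<close> enlarged to \<open>1 + exp t\<close>.\<close>
  have am_gm: "2 * a * exp (t / 2) \<le> a\<^sup>2 * (1 + exp t) + min 1 (exp t)" for t :: real
  proof -
    have e: "exp t = (exp (t / 2))\<^sup>2" by (simp add: exp_double[symmetric])
    have "0 \<le> (a - exp (t / 2))\<^sup>2" "0 \<le> (a * exp (t / 2) - 1)\<^sup>2" by simp_all
    then have "2 * a * exp (t / 2) \<le> a\<^sup>2 + exp t" "2 * a * exp (t / 2) \<le> a\<^sup>2 * exp t + 1"
      unfolding e by (simp_all add: power2_eq_square algebra_simps)
    moreover have "a\<^sup>2 \<ge> 0" "a\<^sup>2 * exp t \<ge> 0" by simp_all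
    moreover have "min 1 (exp t) = 1 \<or> min 1 (exp t) = exp t" by (auto simp: min_def)
    ultimately show ?thesis
      unfolding distrib_left mult_1_right by linarith
  qed
  let ?T = "\<lambda>p. log_ratio_n (fst p) (proposal A f \<kappa> n s (fst p) (snd p))"
  let ?R = "ref_measure f \<kappa> n \<Otimes>\<^sub>M std_gaussian n"
  have "ennreal (2 * a) * ennreal P = (\<integral>\<^sup>+p. ennreal (2 * a * exp (?T p / 2)) \<partial>?R)"
    using nn_integral_exp_half a unfolding P_def
    by (simp add: split_beta' ennreal_mult nn_integral_cmult)
  also have "\<dots> \<le> (\<integral>\<^sup>+p. ennreal (a\<^sup>2) * (1 + ennreal (exp (?T p))) + ennreal (min 1 (exp (?T p))) \<partial>?R)"
  proof (intro nn_integral_mono)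
    fix p
    have "ennreal (2 * a * exp (?T p / 2)) \<le> ennreal (a\<^sup>2 * (1 + exp (?T p)) + min 1 (exp (?T p)))"
      by (intro ennreal_leI am_gm)
    also have "\<dots> = ennreal (a\<^sup>2) * (1 + ennreal (exp (?T p))) + ennreal (min 1 (exp (?T p)))"
      by (simp add: ennreal_mult add_nonneg_nonneg)
    finally show "ennreal (2 * a * exp (?T p / 2)) \<le> \<dots>" .
  qed
  also have "\<dots> = ennreal (a\<^sup>2) * 2 + ref_acceptance"
    using nn_integral_exp_one_plus unfolding ref_acceptance_def
    by (simp add: split_beta' nn_integral_add nn_integral_cmult)
  finally have le: "ennreal (2 * a * P) \<le> ennreal (2 * a\<^sup>2) + ref_acceptance"
    using a P by (simp add: ennreal_mult mult.commute)
  show ?thesis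
  proof (cases ref_acceptance)
    case (real r)
    \<comment> \<open>The choice \<open>a = P / 2\<close> maximises 2 a P - 2 a^2, with value P^2 /
      2.\<close>
    with le have "2 * a * P \<le> 2 * a\<^sup>2 + r"
      by (simp add: ennreal_plus[symmetric] del: ennreal_plus)
    then have "P\<^sup>2 / 2 \<le> r"
      by (simp add: a_def power2_eq_square)
    with real show ?thesis
      unfolding P_def[symmetric] by (simp add: ennreal_leI)
  qed simp
qed

text \<open>The acceptance probability is bounded by 1, so the Bochner integral is a nonnegative
  one. Moving the density into the integrand prepares a pointwise comparison with the reference
  law.\<close>

lemma mean_acceptance_eq:
  "ennreal (mean_acceptance A f \<kappa> n s \<phi>) =
    (\<integral>\<^sup>+(x, z). ennreal (exp (- \<phi> x)) *
        ennreal (acceptance_prob A f \<kappa> n s \<phi> x (proposal A f \<kappa> n s x z))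
      \<partial>(ref_measure f \<kappa> n \<Otimes>\<^sub>M std_gaussian n))" (is "_ = ?I")
  if "prob_space (target_measure f \<kappa> n \<phi>)"
proof -
  interpret T: prob_space "target_measure f \<kappa> n \<phi>" by (rule that)
  interpret G: prob_space "std_gaussian n" by (rule prob_space_std_gaussian)
  interpret TG: pair_prob_space "target_measure f \<kappa> n \<phi>" "std_gaussian n" ..
  let ?a = "\<lambda>p. acceptance_prob A f \<kappa> n s \<phi> (fst p) (proposal A f \<kappa> n s (fst p) (snd p))"
  have [measurable]: "?a \<in> borel_measurable (lebesgue_n n \<Otimes>\<^sub>M lebesgue_n n)"
    unfolding acceptance_prob_eq by measurable
  have a: "0 \<le> ?a p" "?a p \<le> 1" for p
    unfolding acceptance_prob_eq by auto
  have "integrable (target_measure f \<kappa> n \<phi> \<Otimes>\<^sub>M std_gaussian n) ?a"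
    by (rule TG.P.integrable_const_bound[where B = 1]) (use a in auto)
  then have "ennreal (mean_acceptance A f \<kappa> n s \<phi>) =
      (\<integral>\<^sup>+p. ennreal (?a p) \<partial>(target_measure f \<kappa> n \<phi> \<Otimes>\<^sub>M std_gaussian n))"
    unfolding mean_acceptance_def split_beta'
    by (intro nn_integral_eq_integral[symmetric]) (use a in auto)
  also have "\<dots> = (\<integral>\<^sup>+x. \<integral>\<^sup>+z. ennreal (?a (x, z)) \<partial>std_gaussian n \<partial>target_measure f \<kappa> n \<phi>)"
    by (subst G.nn_integral_fst) simp_all
  also have "\<dots> = (\<integral>\<^sup>+x. \<integral>\<^sup>+z. ennreal (exp (- \<phi> x)) * ennreal (?a (x, z))
      \<partial>std_gaussian n \<partial>ref_measure f \<kappa> n)"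
    unfolding target_measure_def
  proof (subst nn_integral_density)
    show "(\<integral>\<^sup>+x. ennreal (exp (- \<phi> x)) * (\<integral>\<^sup>+z. ennreal (?a (x, z)) \<partial>std_gaussian n) \<partial>ref_measure f \<kappa> n) =
        (\<integral>\<^sup>+x. \<integral>\<^sup>+z. ennreal (exp (- \<phi> x)) * ennreal (?a (x, z)) \<partial>std_gaussian n \<partial>ref_measure f \<kappa> n)"
    proof (intro nn_integral_cong nn_integral_cmult[symmetric])
      fix x assume "x \<in> space (ref_measure f \<kappa> n)"
      then have "x \<in> space (lebesgue_n n)" by (simp add: ref_measure_def)
      then have [measurable]: "(\<lambda>z. ?a (x, z)) \<in> borel_measurable (lebesgue_n n)"
        by (rule measurable_Pair2[rotated]) measurable
      show "(\<lambda>z. ennreal (?a (x, z))) \<in> borel_measurable (std_gaussian n)" by measurable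
    qed
  qed measurable
  also have "\<dots> = ?I"
    by (subst G.nn_integral_fst[symmetric]) (simp_all add: split_beta')
  finally show ?thesis .
qed

text \<open>The weight \<open>exp (- \<phi> x)\<close> costs a factor of at most exp M in either
  direction and the ratio \<open>exp (\<phi> x - \<phi> y)\<close> one of at most exp(2 M); together
  these give the exponent 3 M.\<close>

lemma weighted_acceptance_bounds:
  assumes x: "x \<in> space (lebesgue_n n)" and y: "y \<in> space (lebesgue_n n)"
  shows "exp (- 3 * M) * min 1 (exp (log_ratio_n x y)) \<le>
      exp (- \<phi> x) * acceptance_prob A f \<kappa> n s \<phi> x y" (is ?lower)
    and "exp (- \<phi> x) * acceptance_prob A f \<kappa> n s \<phi> x y \<le>
      exp (3 * M) * min 1 (exp (log_ratio_n x y))" (is ?upper)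
proof -
  let ?r = "exp (log_ratio_n x y)"
  have b: "\<bar>\<phi> x\<bar> \<le> M" "\<bar>\<phi> y\<bar> \<le> M" using x y by (auto intro: potential_bounded)
  then have M: "M \<ge> 0" by linarith
  have "exp (- 2 * M) * min 1 ?r \<le> min 1 (exp (\<phi> x - \<phi> y) * ?r)"
  proof (rule min.boundedI)
    have "exp (- 2 * M) * min 1 ?r \<le> 1 * 1" using M by (intro mult_mono) auto
    then show "exp (- 2 * M) * min 1 ?r \<le> 1" by simp
    show "exp (- 2 * M) * min 1 ?r \<le> exp (\<phi> x - \<phi> y) * ?r"
      using b by (intro mult_mono) auto
  qed
  then have "exp (- M) * (exp (- 2 * M) * min 1 ?r) \<le> exp (- \<phi> x) * min 1 (exp (\<phi> x - \<phi> y) * ?r)"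
    using b by (intro mult_mono) auto
  then show ?lower
    unfolding acceptance_prob_eq by (simp add: mult.assoc[symmetric] mult_exp_exp)
  have "min 1 (exp (\<phi> x - \<phi> y) * ?r) \<le> exp (2 * M) * min 1 ?r"
  proof -
    have "1 \<le> exp (2 * M) * 1" using M by simp
    moreover have "exp (\<phi> x - \<phi> y) * ?r \<le> exp (2 * M) * ?r"
      using b by (intro mult_right_mono) auto
    moreover have "min 1 q \<le> e * min 1 r" if "1 \<le> e * 1" "q \<le> e * r" for e q r :: real
      using that by (auto simp: min_def)
    ultimately show ?thesis by blast
  qed
  then have "exp (- \<phi> x) * min 1 (exp (\<phi> x - \<phi> y) * ?r) \<le> exp M * (exp (2 * M) * min 1 ?r)"
    using b by (intro mult_mono) auto
  then show ?upper
    unfolding acceptance_prob_eq by (simp add: mult.assoc[symmetric] mult_exp_exp)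
qed

section \<open>Two-sided bounds for the mean acceptance under the target\<close>

lemma mean_acceptance_bounds:
  assumes "prob_space (target_measure f \<kappa> n \<phi>)"
  shows "mean_acceptance A f \<kappa> n s \<phi> \<ge> exp (- 3 * M) * (\<Prod>i\<in>{1..n}. affinity A g (step i))\<^sup>2 / 2"
      (is ?lower)
    and "mean_acceptance A f \<kappa> n s \<phi> \<le> exp (3 * M) * (\<Prod>i\<in>{1..n}. affinity A g (step i))" (is ?upper)
proof -
  let ?P = "\<Prod>i\<in>{1..n}. affinity A g (step i)"
  let ?R = "ref_measure f \<kappa> n \<Otimes>\<^sub>M std_gaussian n"
  have P: "?P \<ge> 0" by (simp add: prod_nonneg affinity_nonneg)
  have sp: "fst p \<in> space (lebesgue_n n)" if "p \<in> space ?R" for p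
    using that by (auto simp: space_pair_measure ref_measure_def)
  have mean_nonneg: "mean_acceptance A f \<kappa> n s \<phi> \<ge> 0"
    unfolding mean_acceptance_def split_beta' acceptance_prob_eq by (intro integral_nonneg_AE) auto
  have scale: "(\<integral>\<^sup>+p. ennreal c * ennreal (min 1 (exp (log_ratio_n (fst p)
      (proposal A f \<kappa> n s (fst p) (snd p))))) \<partial>?R) = ennreal c * ref_acceptance" for c
    unfolding ref_acceptance_def split_beta' by (rule nn_integral_cmult) simp
  have "ennreal (exp (- 3 * M)) * ennreal (?P\<^sup>2 / 2) \<le> ennreal (exp (- 3 * M)) * ref_acceptance"
    by (intro mult_left_mono ref_acceptance_ge) simp
  also have "\<dots> \<le> ennreal (mean_acceptance A f \<kappa> n s \<phi>)"
    unfolding mean_acceptance_eq[OF assms] scale[symmetric] split_beta'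
      ennreal_mult'[OF exp_ge_zero, symmetric]
    by (intro nn_integral_mono ennreal_leI weighted_acceptance_bounds sp proposal_in_space)
  finally show ?lower
    using mean_nonneg by (simp add: ennreal_mult[symmetric] ennreal_le_iff)
  have "ennreal (mean_acceptance A f \<kappa> n s \<phi>) \<le> ennreal (exp (3 * M)) * ref_acceptance"
    unfolding mean_acceptance_eq[OF assms] scale[symmetric] split_beta'
      ennreal_mult'[OF exp_ge_zero, symmetric]
    by (intro nn_integral_mono ennreal_leI weighted_acceptance_bounds sp proposal_in_space)
  also have "\<dots> \<le> ennreal (exp (3 * M)) * ennreal ?P"
    by (intro mult_left_mono ref_acceptance_le) simp
  finally show ?upper
    using P by (simp add: ennreal_mult[symmetric] ennreal_le_iff)
qed

end

section \<open>Asymptotics\<close>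

text \<open>At least one of \<open>i\<close> and n + 1 - i is n / 2 or more, so adding the sum to
  its reversal gives n terms of size at least (n / 2)^a.\<close>

lemma sum_powr_ge:
  fixes a :: real
  assumes a: "a \<ge> 0"
  shows "real n / 2 * (real n / 2) powr a \<le> (\<Sum>i\<in>{1..n}. real i powr a)"
proof -
  have "real n * (real n / 2) powr a = (\<Sum>i\<in>{1..n}. (real n / 2) powr a)"
    by simp
  also have "\<dots> \<le> (\<Sum>i\<in>{1..n}. real i powr a + real (n + 1 - i) powr a)"
  proof (rule sum_mono)
    fix i assume i: "i \<in> {1..n}"
    then consider "real n / 2 \<le> real i" | "real n / 2 \<le> real (n + 1 - i)"
      by (fastforce simp: of_nat_diff)
    then show "(real n / 2) powr a \<le> real i powr a + real (n + 1 - i) powr a"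
    proof cases
      case 1
      then have "(real n / 2) powr a \<le> real i powr a" using a by (intro powr_mono2) auto
      moreover have "real (n + 1 - i) powr a \<ge> 0" by simp
      ultimately show ?thesis by linarith
    next
      case 2
      then have "(real n / 2) powr a \<le> real (n + 1 - i) powr a" using a by (intro powr_mono2) auto
      moreover have "real i powr a \<ge> 0" by simp
      ultimately show ?thesis by linarith
    qed
  qed
  also have "\<dots> = 2 * (\<Sum>i\<in>{1..n}. real i powr a)"
    unfolding sum.distrib by (subst (2) sum.atLeastAtMost_rev) simp
  finally show ?thesis by simp
qed

text \<open>Makes a product of n factors 1 - B / n bounded below by a constant. It rests on (1 + 2
  x)(1 - x) = 1 + x (1 - 2 x).\<close>

lemma exp_le_one_minus:
  fixes x :: real
  assumes "0 \<le> x" "x \<le> 1 / 2"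
  shows "exp (- (2 * x)) \<le> 1 - x"
proof -
  have "1 \<le> (1 + 2 * x) * (1 - x)"
    using mult_nonneg_nonneg[of x "1 - 2 * x"] assms by (simp add: algebra_simps)
  also have "\<dots> \<le> exp (2 * x) * (1 - x)"
    using assms exp_ge_add_one_self[of "2 * x"] by (intro mult_right_mono) auto
  finally show ?thesis
    by (simp add: exp_minus field_simps)
qed

theorem theorem2:
  fixes f g :: "real \<Rightarrow> real"
    and \<phi> :: "nat \<Rightarrow> (nat \<Rightarrow> real) \<Rightarrow> real"
    and \<sigma> :: "nat \<Rightarrow> real"
    and \<kappa> l \<rho> :: real
    and A :: algorithm
  assumes f_eq: "f = (\<lambda>x. exp (- g x))"
    and f_prob: "prob_space (density lborel (\<lambda>x. ennreal (f x)))"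
    and g_smooth: "infinitely_differentiable g"
    and g_poly: "\<And>k. polynomially_bounded ((deriv ^^ k) g)"
    and f_moments: "\<And>k :: nat. integrable lborel (\<lambda>x. x ^ k * f x)"
    and \<kappa>: "\<kappa> \<ge> 0"
    and \<phi>_measurable: "\<And>n. n \<ge> 1 \<Longrightarrow> \<phi> n \<in> borel_measurable (PiM {1..n} (\<lambda>_. borel))"
    and \<pi>_prob: "\<And>n. n \<ge> 1 \<Longrightarrow> prob_space (target_measure f \<kappa> n (\<phi> n))"
    and l: "l > 0" and \<rho>: "\<rho> > 0"
    and \<sigma>_pos: "\<And>n. n \<ge> 1 \<Longrightarrow> \<sigma> n > 0"
    and \<sigma>_sq: "\<And>n. n \<ge> 1 \<Longrightarrow> (\<sigma> n)\<^sup>2 = l\<^sup>2 * real n powr (- \<rho>)"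
    and \<phi>_bounded: "\<exists>M>0. \<forall>\<^sub>F n in sequentially.
          \<forall>x \<in> space (lebesgue_n n). \<bar>\<phi> n x\<bar> \<le> M"
  shows "(\<rho> \<ge> 2 * \<kappa> + critical_exponent A \<longrightarrow>
            liminf (\<lambda>n. ereal (mean_acceptance A f \<kappa> n (\<sigma> n) (\<phi> n))) > 0) \<and>
         (2 * \<kappa> < \<rho> \<and> \<rho> < 2 * \<kappa> + critical_exponent A \<longrightarrow>
            (\<forall>p::real\<ge>0. (\<lambda>n. real n powr p * mean_acceptance A f \<kappa> n (\<sigma> n) (\<phi> n)) \<longlonglongrightarrow> 0))"
proof -
  interpret smooth_density g
    using f_prob g_smooth g_poly f_moments unfolding f_eq by (simp add: smooth_density_def)
  \<comment> \<open>The critical exponent is 1 / k, so both regimes compare (\<rho> - 2 \<kappa>) k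
    with 1.\<close>
  define k where "k = scaling_order A"
  have k: "k > 0" and I: "critical_exponent A = 1 / real k"
    by (cases A; simp add: k_def)+
  \<comment> \<open>The relative step \<sigma>_n / lambda_i, written out.\<close>
  define h where "h n i = l * real n powr (- \<rho> / 2) * real i powr \<kappa>" for n i
  define P where "P n = (\<Prod>i\<in>{1..n}. affinity A g (h n i))" for n
  have P_nonneg: "P n \<ge> 0" for n
    by (simp add: P_def prod_nonneg affinity_nonneg)
  obtain M where M: "M > 0"
      "\<forall>\<^sub>F n in sequentially. \<forall>x \<in> space (lebesgue_n n). \<bar>\<phi> n x\<bar> \<le> M"
    using \<phi>_bounded by blast
  have \<sigma>: "\<sigma> n = l * real n powr (- \<rho> / 2)" if "n \<ge> 1" for n
  proof (rule power2_eq_imp_eq)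
    show "(\<sigma> n)\<^sup>2 = (l * real n powr (- \<rho> / 2))\<^sup>2"
      using \<sigma>_sq[OF that] that by (simp add: power_mult_distrib powr_power)
  qed (use \<sigma>_pos[OF that] l in auto)
  have bounds: "\<forall>\<^sub>F n in sequentially.
      mean_acceptance A f \<kappa> n (\<sigma> n) (\<phi> n) \<ge> exp (- 3 * M) * (P n)\<^sup>2 / 2 \<and>
      mean_acceptance A f \<kappa> n (\<sigma> n) (\<phi> n) \<le> exp (3 * M) * P n"
    using M(2) eventually_ge_at_top[of 1]
  proof eventually_elim
    case (elim n)
    interpret mh_step g A \<kappa> "\<sigma> n" M n "\<phi> n"
      using elim \<sigma>_pos \<phi>_measurable by unfold_locales auto
    have "step i = h n i" if "i \<in> {1..n}" for i
    proof -
      have "step i = \<sigma> n / coord_scale \<kappa> i" by (rule step_def)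
      then show ?thesis
        unfolding h_def coord_scale_def \<sigma>[OF elim(2), symmetric] by (simp add: powr_minus field_simps)
    qed
    then have "(\<Prod>i\<in>{1..n}. affinity A g (step i)) = P n"
      unfolding P_def by (intro prod.cong) simp_all
    then show ?case
      using mean_acceptance_bounds \<pi>_prob[of n] elim unfolding f_eq by simp
  qed
  have h_pos: "h n i > 0" if "i \<in> {1..n}" for n i
    using l that by (auto simp: h_def)
  have h_le: "h n i \<le> l * real n powr (\<kappa> - \<rho> / 2)" if "i \<in> {1..n}" for n i
  proof -
    have "h n i \<le> l * real n powr (- \<rho> / 2) * real n powr \<kappa>"
      unfolding h_def using l \<kappa> that by (intro mult_left_mono powr_mono2) auto
    then show ?thesis by (simp add: powr_add[symmetric] mult.assoc)
  qed
  have h_power: "h n i ^ (2 * k) = l ^ (2 * k) * real n powr (- (\<rho> * k)) * real i powr (2 * \<kappa> * k)"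
    if "n \<ge> 1" "i \<ge> 1" for n i
    unfolding h_def power_mult_distrib using that k by (simp add: powr_power mult_ac)
  \<comment> \<open>The relative steps are dominated by a null sequence uniformly in
    \<open>i\<close>, so the small-step bounds hold for all coordinates at once.\<close>
  have h_small: "\<forall>\<^sub>F n in sequentially. \<forall>i\<in>{1..n}. h n i \<le> e" if "2 * \<kappa> < \<rho>" "e > 0" for e
  proof -
    have "(\<lambda>n. l * real n powr (\<kappa> - \<rho> / 2)) \<longlonglongrightarrow> 0"
      using that(1) by (intro tendsto_mult_right_zero tendsto_neg_powr filterlim_real_sequentially) auto
    then have "\<forall>\<^sub>F n in sequentially. l * real n powr (\<kappa> - \<rho> / 2) < e"
      using that(2) by (rule order_tendstoD)
    then show ?thesis
      by eventually_elim (use h_le in force)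
  qed
  show ?thesis
  proof (intro conjI impI allI)
    assume "\<rho> \<ge> 2 * \<kappa> + critical_exponent A"
    \<comment> \<open>This is exactly what makes n to the power -(\<rho> - 2 \<kappa>) k at most 1 /
      n, so that n coordinates together lose only a constant factor.\<close>
    then have r: "1 \<le> (\<rho> - 2 * \<kappa>) * k"
      using k by (simp add: I field_simps)
    with k have less: "2 * \<kappa> < \<rho>"
      by (smt (verit) mult_nonpos_nonneg of_nat_0_le_iff)
    obtain C where C: "C \<ge> 0"
        "\<And>t. 0 < t \<Longrightarrow> t \<le> 1 \<Longrightarrow> 1 - C * t ^ (2 * k) \<le> affinity A g t"
      using affinity_lower[of A] unfolding k_def by blast
    \<comment> \<open>\<open>B / n\<close> will bound the deficit of every affinity; for n at least
      2 B it is at most 1/2, as \<open>exp_le_one_minus\<close> requires.\<close>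
    define B where "B = C * l ^ (2 * k)"
    have B: "B \<ge> 0" using C l by (simp add: B_def)
    have "\<forall>\<^sub>F n in sequentially. 2 * B \<le> real n" by real_asymp
    with h_small[OF less zero_less_one] have "\<forall>\<^sub>F n in sequentially. exp (- (2 * B)) \<le> P n"
      using eventually_ge_at_top[of 1]
    proof eventually_elim
      case (elim n)
      have "exp (- (2 * (B / n))) \<le> affinity A g (h n i)" if i: "i \<in> {1..n}" for i
      proof -
        have "h n i ^ (2 * k) \<le> (l * real n powr (\<kappa> - \<rho> / 2)) ^ (2 * k)"
          using h_pos[OF i] h_le[OF i] by (intro power_mono) auto
        also have "\<dots> = l ^ (2 * k) * real n powr (- ((\<rho> - 2 * \<kappa>) * k))"
          using elim k by (simp add: power_mult_distrib powr_power algebra_simps)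
        also have "\<dots> \<le> l ^ (2 * k) * real n powr (- 1)"
          using elim r l by (intro mult_left_mono powr_mono) auto
        finally have *: "C * h n i ^ (2 * k) \<le> C * (l ^ (2 * k) / n)"
          using C elim by (intro mult_left_mono) (auto simp: powr_minus_divide)
        have "exp (- (2 * (B / n))) \<le> 1 - B / n"
          using B elim by (intro exp_le_one_minus) (auto simp: field_simps)
        also have "\<dots> \<le> 1 - C * h n i ^ (2 * k)"
          using * by (simp add: B_def)
        also have "\<dots> \<le> affinity A g (h n i)"
          using elim i h_pos[OF i] by (intro C) auto
        finally show ?thesis .
      qed
      then have "(\<Prod>i\<in>{1..n}. exp (- (2 * (B / n)))) \<le> P n"
        unfolding P_def by (intro prod_mono) auto
      then show ?case
        using elim by (simp add: exp_of_nat_mult[symmetric])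
    qed
    with bounds have "\<forall>\<^sub>F n in sequentially.
        ereal (exp (- 3 * M) * (exp (- (2 * B)))\<^sup>2 / 2) \<le> ereal (mean_acceptance A f \<kappa> n (\<sigma> n) (\<phi> n))"
    proof eventually_elim
      case (elim n)
      have "exp (- 3 * M) * (exp (- (2 * B)))\<^sup>2 / 2 \<le> exp (- 3 * M) * (P n)\<^sup>2 / 2"
        using elim by (intro divide_right_mono mult_left_mono power_mono) auto
      also have "\<dots> \<le> mean_acceptance A f \<kappa> n (\<sigma> n) (\<phi> n)"
        using elim by blast
      finally show ?case by (simp only: ereal_less_eq)
    qed
    then have "ereal (exp (- 3 * M) * (exp (- (2 * B)))\<^sup>2 / 2) \<le>
        liminf (\<lambda>n. ereal (mean_acceptance A f \<kappa> n (\<sigma> n) (\<phi> n)))"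
      by (rule Liminf_bounded)
    then show "liminf (\<lambda>n. ereal (mean_acceptance A f \<kappa> n (\<sigma> n) (\<phi> n))) > 0"
      by (rule less_le_trans[rotated]) simp
  next
    fix p :: real
    assume "2 * \<kappa> < \<rho> \<and> \<rho> < 2 * \<kappa> + critical_exponent A" and p: "p \<ge> 0"
    then have less: "2 * \<kappa> < \<rho>" and \<rho>_less: "\<rho> < 2 * \<kappa> + 1 / k"
      by (auto simp: I)
    \<comment> \<open>Growth exponent of the sum of \<open>h n i ^ (2 * k)\<close> over i: the step
      contributes -\<rho> k and the sum of powers 1 + 2 \<kappa> k. It is positive exactly below the
      critical value.\<close>
    define \<delta> where "\<delta> = 1 + 2 * \<kappa> * k - \<rho> * k"
    have \<delta>: "\<delta> > 0"
      using \<rho>_less k by (simp add: \<delta>_def field_simps)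
    obtain c h0 where c: "c > 0" "h0 > 0"
        "\<And>t. 0 < t \<Longrightarrow> t \<le> h0 \<Longrightarrow> affinity A g t \<le> 1 - c * t ^ (2 * k)"
      using affinity_upper[of A] unfolding k_def by blast
    \<comment> \<open>The last factor is the loss from n / 2 in \<open>sum_powr_ge\<close>.\<close>
    define b where "b = c * l ^ (2 * k) * (1 / 2) powr (1 + 2 * \<kappa> * k)"
    have b: "b > 0" using c l by (simp add: b_def)
    have P_le: "\<forall>\<^sub>F n in sequentially. P n \<le> exp (- b * real n powr \<delta>)"
      using h_small[OF less c(2)] eventually_ge_at_top[of 1]
    proof eventually_elim
      case (elim n)
      have "P n \<le> (\<Prod>i\<in>{1..n}. exp (- (c * h n i ^ (2 * k))))"
        unfolding P_def
      proof (intro prod_mono conjI affinity_nonneg)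
        fix i assume i: "i \<in> {1..n}"
        have "affinity A g (h n i) \<le> 1 - c * h n i ^ (2 * k)"
          using elim h_pos[OF i] i by (intro c) auto
        also have "\<dots> \<le> exp (- (c * h n i ^ (2 * k)))"
          using exp_ge_add_one_self[of "- (c * h n i ^ (2 * k))"] by simp
        finally show "affinity A g (h n i) \<le> exp (- (c * h n i ^ (2 * k)))" .
      qed
      also have "\<dots> = exp (- (c * (\<Sum>i\<in>{1..n}. h n i ^ (2 * k))))"
        by (simp add: exp_sum[symmetric] sum_negf sum_distrib_left)
      also have "(\<Sum>i\<in>{1..n}. h n i ^ (2 * k)) =
          l ^ (2 * k) * real n powr (- (\<rho> * k)) * (\<Sum>i\<in>{1..n}. real i powr (2 * \<kappa> * k))"
        unfolding sum_distrib_left using elim by (intro sum.cong refl h_power) auto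
      also have "exp (- (c * (l ^ (2 * k) * real n powr (- (\<rho> * k)) *
          (\<Sum>i\<in>{1..n}. real i powr (2 * \<kappa> * k))))) \<le>
          exp (- (c * (l ^ (2 * k) * real n powr (- (\<rho> * k)) *
          (real n / 2 * (real n / 2) powr (2 * \<kappa> * k)))))"
        unfolding exp_le_cancel_iff neg_le_iff_le
        using c l \<kappa> by (intro mult_left_mono sum_powr_ge) auto
      also have "real n / 2 * (real n / 2) powr (2 * \<kappa> * k) = (real n * (1 / 2)) powr (1 + 2 * \<kappa> * k)"
        using elim by (simp add: powr_add)
      also have "\<dots> = real n powr (1 + 2 * \<kappa> * k) * (1 / 2) powr (1 + 2 * \<kappa> * k)"
        by (rule powr_mult)
      also have "- (c * (l ^ (2 * k) * real n powr (- (\<rho> * k)) *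
          (real n powr (1 + 2 * \<kappa> * k) * (1 / 2) powr (1 + 2 * \<kappa> * k)))) =
          - b * (real n powr (1 + 2 * \<kappa> * k) * real n powr (- (\<rho> * k)))"
        by (simp add: b_def)
      also have "real n powr (1 + 2 * \<kappa> * k) * real n powr (- (\<rho> * k)) = real n powr \<delta>"
        by (simp add: powr_add[symmetric] \<delta>_def)
      finally show ?case .
    qed
    \<comment> \<open>A stretched exponential decays faster than any power of n grows.\<close>
    have lim: "(\<lambda>n. real n powr p * (exp (3 * M) * exp (- b * real n powr \<delta>))) \<longlonglongrightarrow> 0"
      using b \<delta> p by real_asymp
    show "(\<lambda>n. real n powr p * mean_acceptance A f \<kappa> n (\<sigma> n) (\<phi> n)) \<longlonglongrightarrow> 0"
    proof (rule Lim_null_comparison[OF _ lim])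
      show "\<forall>\<^sub>F n in sequentially. norm (real n powr p * mean_acceptance A f \<kappa> n (\<sigma> n) (\<phi> n)) \<le>
          real n powr p * (exp (3 * M) * exp (- b * real n powr \<delta>))"
        using bounds P_le
      proof eventually_elim
        case (elim n)
        let ?a = "mean_acceptance A f \<kappa> n (\<sigma> n) (\<phi> n)"
        have "0 \<le> exp (- 3 * M) * (P n)\<^sup>2 / 2" by simp
        then have "0 \<le> ?a" using elim by linarith
        moreover have "exp (3 * M) * P n \<le> exp (3 * M) * exp (- b * real n powr \<delta>)"
          using elim by (intro mult_left_mono) auto
        then have "?a \<le> exp (3 * M) * exp (- b * real n powr \<delta>)" using elim by linarith
        ultimately show ?case
          unfolding norm_mult by (intro mult_mono) auto
      qed
    qed
  qed
qed

end
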